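(* Let $\lambda$ be Lebesgue measure on $[0,1]$, let $j:[0,1]\to\mathbf I\mathbb R^\star$, $j(x)=[x,x]$, and let $j[\lambda]$ be the image measure on $\mathbf I\mathbb R^\star$. Let $\overline\lambda=\sup_{n\in\mathbb N}\overline\lambda_n$ in $\mathbf V^{\mathbf I\mathbb R_+^\star}(\mathbf I\mathbb R^\star)$, where $\overline\lambda_n=\sum_{i=1}^{2^n}\left[\tfrac1{2^n},\tfrac1{2^n}\right]\times\delta_{[\frac{i-1}{2^n},\frac i{2^n}]}$ (an ascending chain). Then $\overline\lambda=\widetilde{j[\lambda]}$, and it is the largest continuous $\mathbf I\mathbb R_+^\star$-valuation on $\mathbf I\mathbb R^\star$ that approximates $j[\lambda]$. In particular, $\widetilde{j[\lambda]}=\overline\lambda$ is in $\mathbf V^{\mathbf I\mathbb R_+^\star}_m(\mathbf I\mathbb R^\star)$.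
   Context: $\overline{\mathbb R}_+=[0,+\infty]$. $\mathbf I\mathbb R^\star$ is the dcpo of closed intervals $[a,b]$ with $a,b\in\mathbb R\cup\{-\infty,+\infty\}$, $a\le b$, ordered by reverse inclusion, with its Scott topology; $\mathbf I\mathbb R_+^\star$ is the subdcpo of those $[a,b]$ with $a\ge 0$. $\mathbf I\mathbb R_+^\star$ carries $0=[0,0]$, $1=[1,1]$, $[a,b]+[c,d]=[a+c,b+d]$, $[a,b]\times[c,d]=[a\cdot_\ell c,\ b\cdot_r d]$, where $\cdot_\ell$ and $\cdot_r$ are the usual product except that $0\cdot_\ell(+\infty)=(+\infty)\cdot_\ell 0=0$ and $0\cdot_r(+\infty)=(+\infty)\cdot_r 0=+\infty$. For a topological space $X$, $\mathcal L^{\mathbf I\mathbb R_+^\star}X$ is the dcpo of continuous maps $h:X\to\mathbf I\mathbb R_+^\star$, ordered pointwise, with pointwise $+$ and $\times$; write $h(x)=[h^-(x),h^+(x)]$. A continuous $\mathbf I\mathbb R_+^\star$-valuation on $X$ is a Scott-continuous map $\nu:\mathcal L^{\mathbf I\mathbb R_+^\star}X\to\mathbf I\mathbb R_+^\star$ with $\nu(\mathbf a\times h)=\mathbf a\times\nu(h)$ and $\nu(h+h')=\nu(h)+\nu(h')$ for all $\mathbf a\in\mathbf I\mathbb R_+^\star$ and all $h,h'$. $\mathbf V^{\mathbf I\mathbb R_+^\star}X$ is the dcpo of these, ordered pointwise. $\delta_x$ is $h\mapsto h(x)$; sums and scalar multiples are pointwise. An elementary valuation is a sum $\sum_{i=1}^n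 r_i\times\delta_{x_i}$ with $n\ge1$, $r_i\in\mathbf I\mathbb R_+^\star$, $x_i\in X$. $\mathbf V^{\mathbf I\mathbb R_+^\star}_m X$ is the smallest subset of $\mathbf V^{\mathbf I\mathbb R_+^\star}X$ containing the elementary valuations and closed under directed suprema. Measures on $X$ are $\overline{\mathbb R}_+$-valued measures on the Borel $\sigma$-algebra. The image measure is $j[\lambda](E)=\lambda(j^{-1}(E))$. A measure $\mu$ is $\tau$-smooth if $\mu(\bigcup_i U_i)=\sup_i\mu(U_i)$ for every directed family of open sets (every measure on a second-countable space, such as $\mathbf I\mathbb R^\star$, is $\tau$-smooth). A support of $\mu$ is a set $E\subseteq X$ such that for all measurable $A,B$ with $A\cap E=B\cap E$, $\mu(A)=\mu(B)$. For $\tau$-smooth $\mu$, $\operatorname{supp}\mu$ is the smallest closed support of $\mu$. Lower integral of a measurable $f:X\to\overline{\mathbb R}_+$: $\int_{x\in X}^- f(x)\,d\mu=\sup_{r\in\mathbb R_+}\int_{x\in X}\min(f(x),r)\,d\mu$. $f$ is $\mu$-bounded if there is a measurable compact saturated support $Q$ of $\mu$ with $\sup_{x\in Q\cap\operatorname{supp}\mu}f(x)<\infty$ (saturated = intersection of open sets). For upper semicontinuous $f:X\to\overline{\mathbb R}_+$, $\int_{x\in X}^+ f(x)\,d\mu$ is $\int_{x\in X}^- f(x)\,d\mu$ if $f$ is $\mu$-bounded, and $\infty$ otherwise. For $\tau$-smooth $\mu$, $\widetilde\mu(h)=\left[\int_{x\in X}^- h^-(x)\,d\mu,\ \int_{x\in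 X}^+ h^+(x)\,d\mu\right]$. An interval $[a,b]$ approximates $x$ if $a\le x\le b$; $h\in\mathcal L^{\mathbf I\mathbb R_+^\star}X$ approximates a measurable $f:X\to\overline{\mathbb R}_+$ if $h(x)$ approximates $f(x)$ for every $x$; a continuous $\mathbf I\mathbb R_+^\star$-valuation $\nu$ approximates a measure $\mu$ if for every measurable $f:X\to\overline{\mathbb R}_+$ and every $h$ approximating $f$, $\nu(h)$ approximates $\int_{x\in X}^- f(x)\,d\mu$. *)

theory Defs
  imports "HOL-Analysis.Analysis"
begin

section \<open>Directed suprema and the Scott topology\<close>

text \<open>Supremum of \<open>D\<close> computed in the subposet \<open>P\<close>; meant for \<open>D \<subseteq> P\<close>.\<close>
definition is_sup_in :: "'a::order set \<Rightarrow> 'a set \<Rightarrow> 'a \<Rightarrow> bool" where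
  "is_sup_in P D s \<longleftrightarrow>
     s \<in> P \<and> (\<forall>d\<in>D. d \<le> s) \<and> (\<forall>u\<in>P. (\<forall>d\<in>D. d \<le> u) \<longrightarrow> s \<le> u)"

abbreviation is_sup :: "'a::order set \<Rightarrow> 'a \<Rightarrow> bool" where
  "is_sup \<equiv> is_sup_in UNIV"

definition directed :: "'a::order set \<Rightarrow> bool" where
  "directed D \<longleftrightarrow> D \<noteq> {} \<and> (\<forall>a\<in>D. \<forall>b\<in>D. \<exists>c\<in>D. a \<le> c \<and> b \<le> c)"

definition scott_open :: "'a::order set \<Rightarrow> bool" where
  "scott_open U \<longleftrightarrow>
     (\<forall>x\<in>U. \<forall>y. x \<le> y \<longrightarrow> y \<in> U) \<and>
     (\<forall>D s. directed D \<longrightarrow> is_sup D s \<longrightarrow> s \<in> U \<longrightarrow> D \<inter> U \<noteq> {})"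

definition scott_continuous :: "('a::order \<Rightarrow> 'b::order) \<Rightarrow> bool" where
  "scott_continuous f \<longleftrightarrow>
     mono f \<and> (\<forall>D s. directed D \<longrightarrow> is_sup D s \<longrightarrow> is_sup (f ` D) (f s))"

section \<open>Interval domains\<close>

text \<open>
  The type \<open>'a interval\<close> of \<open>HOL-Library\<close> is ordered by inclusion and carries a Hausdorff topology;
  here the order is reverse inclusion and the topology is the Scott topology.
\<close>
typedef (overloaded) 'a ivl = "{(a::'a::order, b). a \<le> b}"
  morphisms bounds Ivl
  by auto

setup_lifting type_definition_ivl

lift_definition lower :: "'a::order ivl \<Rightarrow> 'a" is fst .
lift_definition upper :: "'a::order ivl \<Rightarrow> 'a" is snd .

lemma lower_le_upper: "lower I \<le> upper I"
  by transfer auto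

lemma lower_Ivl [simp]: "a \<le> b \<Longrightarrow> lower (Ivl (a, b)) = a"
  and upper_Ivl [simp]: "a \<le> b \<Longrightarrow> upper (Ivl (a, b)) = b"
  by (simp_all add: lower_def upper_def Ivl_inverse)

lemma ivl_eq_iff: "I = J \<longleftrightarrow> lower I = lower J \<and> upper I = upper J"
  by transfer auto

instantiation ivl :: (order) order
begin
definition "I \<le> J \<longleftrightarrow> lower I \<le> lower J \<and> upper J \<le> upper I" for I J :: "'a ivl"
definition "I < J \<longleftrightarrow> I \<le> J \<and> \<not> J \<le> I" for I J :: "'a ivl"
instance
  by standard (auto simp: less_eq_ivl_def less_ivl_def ivl_eq_iff)
end

lemma scott_openI:
  assumes "\<And>x y. x \<in> U \<Longrightarrow> x \<le> y \<Longrightarrow> y \<in> U"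
    and "\<And>D s. directed D \<Longrightarrow> is_sup D s \<Longrightarrow> s \<in> U \<Longrightarrow> \<exists>d\<in>D. d \<in> U"
  shows "scott_open U"
  using assms unfolding scott_open_def disjoint_iff by metis

lemma scott_openD:
  assumes "scott_open U"
  shows "x \<in> U \<Longrightarrow> x \<le> y \<Longrightarrow> y \<in> U"
    and "directed D \<Longrightarrow> is_sup D s \<Longrightarrow> s \<in> U \<Longrightarrow> \<exists>d\<in>D. d \<in> U"
  using assms unfolding scott_open_def disjoint_iff by metis+

lemma directedD:
  assumes "directed D" "a \<in> D" "b \<in> D"
  obtains c where "c \<in> D" "a \<le> c" "b \<le> c"
  using assms unfolding directed_def by metis

instantiation ivl :: (order) topological_space
begin
definition "open U \<longleftrightarrow> scott_open U" for U :: "'a ivl set"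
instance
proof
  show "open (UNIV :: 'a ivl set)"
    by (simp add: open_ivl_def scott_open_def directed_def)
next
  fix S T :: "'a ivl set"
  assume ST: "open S" "open T"
  then have S: "scott_open S" and T: "scott_open T"
    by (simp_all add: open_ivl_def)
  have "scott_open (S \<inter> T)"
  proof (rule scott_openI)
    fix x y assume "x \<in> S \<inter> T" "x \<le> y"
    then show "y \<in> S \<inter> T"
      using scott_openD(1)[OF S, of x y] scott_openD(1)[OF T, of x y] by simp
  next
    fix D s assume D: "directed D" "is_sup D s" "s \<in> S \<inter> T"
    obtain a where a: "a \<in> D" "a \<in> S"
      using scott_openD(2)[OF S D(1,2)] D(3) by auto
    obtain b where b: "b \<in> D" "b \<in> T"
      using scott_openD(2)[OF T D(1,2)] D(3) by auto
    obtain c where c: "c \<in> D" "a \<le> c" "b \<le> c"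
      using directedD[OF D(1) a(1) b(1)] .
    show "\<exists>d\<in>D. d \<in> S \<inter> T"
      using scott_openD(1)[OF S a(2) c(2)] scott_openD(1)[OF T b(2) c(3)] c(1) by auto
  qed
  then show "open (S \<inter> T)"
    by (simp add: open_ivl_def)
next
  fix K :: "'a ivl set set"
  assume "\<forall>S\<in>K. open S"
  then have K: "scott_open S" if "S \<in> K" for S
    using that by (simp add: open_ivl_def)
  have "scott_open (\<Union>K)"
  proof (rule scott_openI)
    fix x y assume "x \<in> \<Union>K" "x \<le> y"
    then show "y \<in> \<Union>K"
      using scott_openD(1)[OF K] by (metis UnionE UnionI)
  next
    fix D s assume D: "directed D" "is_sup D s" "s \<in> \<Union>K"
    then obtain S where S: "S \<in> K" "s \<in> S"
      by auto
    then show "\<exists>d\<in>D. d \<in> \<Union>K"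
      using scott_openD(2)[OF K[OF S(1)] D(1,2) S(2)] by auto
  qed
  then show "open (\<Union>K)"
    by (simp add: open_ivl_def)
qed
end

type_synonym IR = "ereal ivl"
type_synonym IRp = "ennreal ivl"

instantiation ivl :: (ordered_comm_monoid_add) comm_monoid_add
begin
lift_definition zero_ivl :: "'a ivl" is "(0, 0)" by auto
lift_definition plus_ivl :: "'a ivl \<Rightarrow> 'a ivl \<Rightarrow> 'a ivl" is "\<lambda>(a, b) (c, d). (a + c, b + d)"
  by (auto intro!: add_mono)
instance
  by (standard; transfer) (auto simp: ac_simps)
end

lemma lower_plus [simp]: "lower (I + J) = lower I + lower J"
  and upper_plus [simp]: "upper (I + J) = upper I + upper J"
  by (transfer, auto)+

text \<open>
  Multiplication on \<open>ennreal\<close> has \<open>0 * \<infinity> = 0\<close>, so it is the product for left end-points;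
  right end-points use \<open>0 * \<infinity> = \<infinity>\<close>.
\<close>
definition mult_r :: "ennreal \<Rightarrow> ennreal \<Rightarrow> ennreal" where
  "mult_r a b = (if a = 0 \<and> b = \<infinity> \<or> a = \<infinity> \<and> b = 0 then \<infinity> else a * b)"

lemma mult_le_mult_r: "a \<le> c \<Longrightarrow> b \<le> d \<Longrightarrow> a * b \<le> mult_r c d"
  by (simp add: mult_r_def mult_mono)

lift_definition times_ivl :: "IRp \<Rightarrow> IRp \<Rightarrow> IRp" (infixl \<open>\<odot>\<close> 70)
  is "\<lambda>(a, b) (c, d). (a * c, mult_r b d)"
  by (auto intro!: mult_le_mult_r)

lemma lower_times [simp]: "lower (I \<odot> J) = lower I * lower J"
  and upper_times [simp]: "upper (I \<odot> J) = mult_r (upper I) (upper J)"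
  by (transfer, auto)+

subsection \<open>Continuity of interval-valued maps\<close>

lemma is_sup_ivlI:
  fixes D :: "'a::complete_linorder ivl set"
  assumes "lower s = (SUP I\<in>D. lower I)" "upper s = (INF I\<in>D. upper I)"
  shows "is_sup D s"
  using assms by (auto simp: is_sup_in_def less_eq_ivl_def
      intro: SUP_upper INF_lower SUP_least INF_greatest)

lemma directed_ivl_bounds:
  fixes D :: "'a::complete_linorder ivl set"
  assumes D: "directed D" and s: "is_sup D s"
  shows "lower s = (SUP I\<in>D. lower I)" "upper s = (INF I\<in>D. upper I)"
proof -
  have "lower I \<le> upper J" if IJ: "I \<in> D" "J \<in> D" for I J
  proof -
    obtain K where "I \<le> K" "J \<le> K"
      using directedD[OF D IJ] .
    then show ?thesis
      unfolding less_eq_ivl_def by (metis lower_le_upper order_trans)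
  qed
  then have le: "(SUP I\<in>D. lower I) \<le> (INF I\<in>D. upper I)"
    by (intro SUP_least INF_greatest)
  define t where "t = Ivl ((SUP I\<in>D. lower I), (INF I\<in>D. upper I))"
  have t: "lower t = (SUP I\<in>D. lower I)" "upper t = (INF I\<in>D. upper I)"
    using le by (simp_all add: t_def)
  have "is_sup D t"
    using t by (rule is_sup_ivlI)
  then have "s = t"
    using s by (intro order.antisym) (auto simp: is_sup_in_def)
  then show "lower s = (SUP I\<in>D. lower I)" "upper s = (INF I\<in>D. upper I)"
    using t by auto
qed

lemma open_lower_greater: "open {I :: 'a::complete_linorder ivl. c < lower I}"
  unfolding open_ivl_def
proof (rule scott_openI)
  fix D and s :: "'a ivl"
  assume "directed D" "is_sup D s" "s \<in> {I. c < lower I}"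
  then show "\<exists>d\<in>D. d \<in> {I. c < lower I}"
    by (simp add: directed_ivl_bounds less_SUP_iff)
qed (auto simp: less_eq_ivl_def)

lemma open_upper_less: "open {I :: 'a::complete_linorder ivl. upper I < c}"
  unfolding open_ivl_def
proof (rule scott_openI)
  fix D and s :: "'a ivl"
  assume "directed D" "is_sup D s" "s \<in> {I. upper I < c}"
  then show "\<exists>d\<in>D. d \<in> {I. upper I < c}"
    by (simp add: directed_ivl_bounds INF_less_iff)
qed (auto simp: less_eq_ivl_def)

lemma open_ivl_box:
  fixes U :: "'a::{complete_linorder, dense_linorder} ivl set"
  assumes U: "open U" and I: "I \<in> U"
  obtains a b where "a = bot \<or> a < lower I" "b = top \<or> upper I < b"
    "\<And>J. (a = bot \<or> a < lower J) \<Longrightarrow> (b = top \<or> upper J < b) \<Longrightarrow> J \<in> U"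
proof -
  define D where
    "D = {K. (lower K = bot \<or> lower K < lower I) \<and> (upper K = top \<or> upper I < upper K)}"
  have K: "a \<le> b \<and> Ivl (a, b) \<in> D"
    if "a = bot \<or> a < lower I" "b = top \<or> upper I < b" for a b
  proof -
    have "a \<le> b"
      using that lower_le_upper[of I] by auto
    then show ?thesis
      using that by (simp add: D_def)
  qed
  have "directed D"
    unfolding directed_def
  proof (intro conjI ballI)
    show "D \<noteq> {}"
      using K[of bot top] by auto
    fix J K' assume JK: "J \<in> D" "K' \<in> D"
    let ?a = "max (lower J) (lower K')" and ?b = "min (upper J) (upper K')"
    have "?a \<le> ?b \<and> Ivl (?a, ?b) \<in> D"
      using JK by (intro K) (auto simp: D_def max_def min_def)
    then show "\<exists>c\<in>D. J \<le> c \<and> K' \<le> c"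
      by (intro bexI[of _ "Ivl (?a, ?b)"]) (auto simp: less_eq_ivl_def)
  qed
  moreover have "is_sup D I"
  proof (rule is_sup_ivlI)
    show "lower I = (SUP K\<in>D. lower K)"
    proof (rule order.antisym)
      show "lower I \<le> (SUP K\<in>D. lower K)"
      proof (rule dense_le)
        fix x assume "x < lower I"
        then have "x \<le> top \<and> Ivl (x, top) \<in> D"
          by (intro K) auto
        then show "x \<le> (SUP K\<in>D. lower K)"
          by (metis SUP_upper lower_Ivl)
      qed
    qed (auto simp: D_def intro!: SUP_least)
    show "upper I = (INF K\<in>D. upper K)"
    proof (rule order.antisym)
      show "(INF K\<in>D. upper K) \<le> upper I"
      proof (rule dense_ge)
        fix x assume "upper I < x"
        then have "bot \<le> x \<and> Ivl (bot, x) \<in> D"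
          by (intro K) auto
        then show "(INF K\<in>D. upper K) \<le> x"
          by (metis INF_lower upper_Ivl)
      qed
    qed (auto simp: D_def intro!: INF_greatest)
  qed
  ultimately obtain K where "K \<in> D" "K \<in> U"
    using scott_openD(2)[OF U[unfolded open_ivl_def]] I by metis
  show thesis
  proof (rule that)
    show "lower K = bot \<or> lower K < lower I" "upper K = top \<or> upper I < upper K"
      using \<open>K \<in> D\<close> by (auto simp: D_def)
    fix J :: "'a ivl"
    assume "lower K = bot \<or> lower K < lower J" "upper K = top \<or> upper J < upper K"
    then have "K \<le> J"
      by (auto simp: less_eq_ivl_def)
    then show "J \<in> U"
      using scott_openD(1)[OF U[unfolded open_ivl_def] \<open>K \<in> U\<close>] by simp
  qed
qed

lemma continuous_ivl_iff:
  fixes h :: "'x::topological_space \<Rightarrow> 'a::{complete_linorder, dense_linorder} ivl"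
  shows "continuous_on UNIV h \<longleftrightarrow>
    (\<forall>c. open {x. c < lower (h x)}) \<and> (\<forall>c. open {x. upper (h x) < c})"
proof safe
  fix c assume h: "continuous_on UNIV h"
  show "open {x. c < lower (h x)}" "open {x. upper (h x) < c}"
    using open_vimage[OF open_lower_greater h] open_vimage[OF open_upper_less h]
    by (simp_all add: vimage_def)
next
  assume l: "\<forall>c. open {x. c < lower (h x)}" and u: "\<forall>c. open {x. upper (h x) < c}"
  show "continuous_on UNIV h"
    unfolding continuous_on_open_vimage[OF open_UNIV]
  proof safe
    fix U :: "'a ivl set" assume U: "open U"
    have "\<exists>T. open T \<and> x \<in> T \<and> T \<subseteq> h -` U" if hx: "h x \<in> U" for x
    proof -
      obtain a b where ab: "a = bot \<or> a < lower (h x)" "b = top \<or> upper (h x) < b"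
        "\<And>J. (a = bot \<or> a < lower J) \<Longrightarrow> (b = top \<or> upper J < b) \<Longrightarrow> J \<in> U"
        using open_ivl_box[OF U hx] by blast
      let ?S = "if a = bot then UNIV else {x. a < lower (h x)}"
      let ?T = "if b = top then UNIV else {x. upper (h x) < b}"
      have "open (?S \<inter> ?T)"
        using l u by auto
      moreover have "x \<in> ?S \<inter> ?T"
        using ab(1,2) by auto
      moreover have "?S \<inter> ?T \<subseteq> h -` U"
        using ab(3) by (auto split: if_splits)
      ultimately show ?thesis
        by blast
    qed
    then have "open (h -` U)"
      by (subst open_subopen) auto
    then show "open (h -` U \<inter> UNIV)"
      by simp
  qed
qed

lemma open_greater_mono2:
  fixes F :: "'a::linorder_topology \<Rightarrow> 'a \<Rightarrow> 'a"
  assumes mono: "\<And>a a' b b'. a \<le> a' \<Longrightarrow> b \<le> b' \<Longrightarrow> F a b \<le> F a' b'"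
    and lim: "\<And>a b. c < F a b \<Longrightarrow>
      ((\<lambda>p. F (fst p) (snd p)) \<longlongrightarrow> F a b) (nhds a \<times>\<^sub>F nhds b)"
    and f: "\<And>d. open {x. d < f x}" and g: "\<And>d. open {x. d < g x}"
  shows "open {x::'x::topological_space. c < F (f x) (g x)}"
proof (subst open_subopen, safe)
  fix x assume x: "c < F (f x) (g x)"
  have "eventually (\<lambda>p. c < F (fst p) (snd p)) (nhds (f x) \<times>\<^sub>F nhds (g x))"
    using order_tendstoD(1)[OF lim[OF x] x] .
  then obtain P Q where PQ: "eventually P (nhds (f x))" "eventually Q (nhds (g x))"
    "\<And>a b. P a \<Longrightarrow> Q b \<Longrightarrow> c < F a b"
    unfolding eventually_prod_filter by auto
  have nb: "\<exists>S. open S \<and> x \<in> S \<and> (\<forall>y\<in>S. \<exists>a. P a \<and> a \<le> k y)"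
    if P: "eventually P (nhds (k x))" and k: "\<And>d. open {x. d < k x}"
    for P and k :: "'x \<Rightarrow> 'a"
  proof -
    obtain A where A: "open A" "k x \<in> A" "\<And>a. a \<in> A \<Longrightarrow> P a"
      using P unfolding eventually_nhds by blast
    show ?thesis
    proof (cases "\<exists>d. d < k x")
      case True
      then obtain d where d: "d < k x" "{d<..k x} \<subseteq> A"
        using open_left[OF A(1,2)] by blast
      have "\<exists>a. P a \<and> a \<le> k y" if "d < k y" for y
      proof (intro exI conjI)
        have "min (k x) (k y) \<in> {d<..k x}"
          using d(1) that by simp
        then show "P (min (k x) (k y))"
          using d(2) A(3) by blast
      qed simp
      then show ?thesis
        using d(1) k[of d] by (intro exI[of _ "{x. d < k x}"]) simp
    next
      case False
      then show ?thesis
        using A by (intro exI[of _ UNIV]) (auto simp: not_less)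
    qed
  qed
  obtain S where S: "open S" "x \<in> S" "\<And>y. y \<in> S \<Longrightarrow> \<exists>a. P a \<and> a \<le> f y"
    using nb[OF PQ(1) f] by blast
  obtain T where T: "open T" "x \<in> T" "\<And>y. y \<in> T \<Longrightarrow> \<exists>b. Q b \<and> b \<le> g y"
    using nb[OF PQ(2) g] by blast
  have "c < F (f y) (g y)" if y: "y \<in> S \<inter> T" for y
  proof -
    obtain a b where ab: "P a" "a \<le> f y" "Q b" "b \<le> g y"
      using S(3)[of y] T(3)[of y] y by auto
    show ?thesis
      using PQ(3)[OF ab(1,3)] mono[OF ab(2,4)] by (rule less_le_trans)
  qed
  then show "\<exists>T. open T \<and> x \<in> T \<and> T \<subseteq> {x. c < F (f x) (g x)}"
    using S(1,2) T(1,2) by (intro exI[of _ "S \<inter> T"]) auto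
qed

lemma open_less_mono2:
  fixes F :: "'a::linorder_topology \<Rightarrow> 'a \<Rightarrow> 'a"
  assumes mono: "\<And>a a' b b'. a \<le> a' \<Longrightarrow> b \<le> b' \<Longrightarrow> F a b \<le> F a' b'"
    and lim: "\<And>a b. F a b < c \<Longrightarrow>
      ((\<lambda>p. F (fst p) (snd p)) \<longlongrightarrow> F a b) (nhds a \<times>\<^sub>F nhds b)"
    and f: "\<And>d. open {x. f x < d}" and g: "\<And>d. open {x. g x < d}"
  shows "open {x::'x::topological_space. F (f x) (g x) < c}"
proof (subst open_subopen, safe)
  fix x assume x: "F (f x) (g x) < c"
  have "eventually (\<lambda>p. F (fst p) (snd p) < c) (nhds (f x) \<times>\<^sub>F nhds (g x))"
    using order_tendstoD(2)[OF lim[OF x] x] .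
  then obtain P Q where PQ: "eventually P (nhds (f x))" "eventually Q (nhds (g x))"
    "\<And>a b. P a \<Longrightarrow> Q b \<Longrightarrow> F a b < c"
    unfolding eventually_prod_filter by auto
  have nb: "\<exists>S. open S \<and> x \<in> S \<and> (\<forall>y\<in>S. \<exists>a. P a \<and> k y \<le> a)"
    if P: "eventually P (nhds (k x))" and k: "\<And>d. open {x. k x < d}"
    for P and k :: "'x \<Rightarrow> 'a"
  proof -
    obtain A where A: "open A" "k x \<in> A" "\<And>a. a \<in> A \<Longrightarrow> P a"
      using P unfolding eventually_nhds by blast
    show ?thesis
    proof (cases "\<exists>d. k x < d")
      case True
      then obtain d where d: "k x < d" "{k x..<d} \<subseteq> A"
        using open_right[OF A(1,2)] by blast
      have "\<exists>a. P a \<and> k y \<le> a" if "k y < d" for y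
      proof (intro exI conjI)
        have "max (k x) (k y) \<in> {k x..<d}"
          using d(1) that by simp
        then show "P (max (k x) (k y))"
          using d(2) A(3) by blast
      qed simp
      then show ?thesis
        using d(1) k[of d] by (intro exI[of _ "{x. k x < d}"]) simp
    next
      case False
      then show ?thesis
        using A by (intro exI[of _ UNIV]) (auto simp: not_less)
    qed
  qed
  obtain S where S: "open S" "x \<in> S" "\<And>y. y \<in> S \<Longrightarrow> \<exists>a. P a \<and> f y \<le> a"
    using nb[OF PQ(1) f] by blast
  obtain T where T: "open T" "x \<in> T" "\<And>y. y \<in> T \<Longrightarrow> \<exists>b. Q b \<and> g y \<le> b"
    using nb[OF PQ(2) g] by blast
  have "F (f y) (g y) < c" if y: "y \<in> S \<inter> T" for y
  proof -
    obtain a b where ab: "P a" "f y \<le> a" "Q b" "g y \<le> b"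
      using S(3)[of y] T(3)[of y] y by auto
    show ?thesis
      using mono[OF ab(2,4)] PQ(3)[OF ab(1,3)] by (rule le_less_trans)
  qed
  then show "\<exists>T. open T \<and> x \<in> T \<and> T \<subseteq> {x. F (f x) (g x) < c}"
    using S(1,2) T(1,2) by (intro exI[of _ "S \<inter> T"]) auto
qed

lemma tendsto_fst_nhds_prod: "(fst \<longlongrightarrow> a) (nhds a \<times>\<^sub>F nhds b)"
  and tendsto_snd_nhds_prod: "(snd \<longlongrightarrow> b) (nhds a \<times>\<^sub>F nhds b)"
  by (simp_all add: filterlim_fst filterlim_snd)

lemma mult_r_mono: "a \<le> a' \<Longrightarrow> b \<le> b' \<Longrightarrow> mult_r a b \<le> mult_r a' b'"
  by (auto simp: mult_r_def top_unique intro!: mult_mono)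

lemma mult_r_finite: "mult_r a b < c \<Longrightarrow> a < \<infinity> \<and> b < \<infinity>"
  using less_le_trans[of "a * b" c top]
  by (auto simp: mult_r_def ennreal_mult_less_top less_top[symmetric] split: if_splits)

lemma continuous_plus_ivl:
  fixes h k :: "'x::topological_space \<Rightarrow> IRp"
  assumes h: "continuous_on UNIV h" and k: "continuous_on UNIV k"
  shows "continuous_on UNIV (\<lambda>x. h x + k x)"
proof -
  note hk = h[unfolded continuous_ivl_iff] k[unfolded continuous_ivl_iff]
  have lim: "((\<lambda>p. fst p + snd p) \<longlongrightarrow> a + b) (nhds a \<times>\<^sub>F nhds b)" for a b :: ennreal
    by (intro tendsto_add tendsto_fst_nhds_prod tendsto_snd_nhds_prod)
  have "open {x. c < lower (h x) + lower (k x)}" for c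
    by (rule open_greater_mono2[where F = "(+)", OF add_mono lim]) (simp_all add: hk)
  moreover have "open {x. upper (h x) + upper (k x) < c}" for c
    by (rule open_less_mono2[where F = "(+)", OF add_mono lim]) (simp_all add: hk)
  ultimately show ?thesis
    by (simp add: continuous_ivl_iff)
qed

lemma continuous_times_ivl:
  fixes h k :: "'x::topological_space \<Rightarrow> IRp"
  assumes h: "continuous_on UNIV h" and k: "continuous_on UNIV k"
  shows "continuous_on UNIV (\<lambda>x. h x \<odot> k x)"
proof -
  note hk = h[unfolded continuous_ivl_iff] k[unfolded continuous_ivl_iff]
  have lim: "((\<lambda>p. fst p * snd p) \<longlongrightarrow> a * b) (nhds a \<times>\<^sub>F nhds b)"
    if "a \<noteq> 0 \<or> b \<noteq> \<infinity>" "b \<noteq> 0 \<or> a \<noteq> \<infinity>" for a b :: ennreal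
    using that by (intro tendsto_mult_ennreal tendsto_fst_nhds_prod tendsto_snd_nhds_prod) auto
  have lim_r: "((\<lambda>p. mult_r (fst p) (snd p)) \<longlongrightarrow> mult_r a b) (nhds a \<times>\<^sub>F nhds b)"
    if "mult_r a b < c" for a b c
  proof -
    have ab: "a < \<infinity>" "b < \<infinity>"
      using mult_r_finite[OF that] by simp_all
    then have ab': "a \<noteq> 0 \<or> b \<noteq> \<infinity>" "b \<noteq> 0 \<or> a \<noteq> \<infinity>"
      by auto
    have "eventually (\<lambda>p. fst p < \<infinity> \<and> snd p < \<infinity>) (nhds a \<times>\<^sub>F nhds b)"
      using order_tendstoD(2)[OF tendsto_fst_nhds_prod ab(1)]
        order_tendstoD(2)[OF tendsto_snd_nhds_prod ab(2)] by (rule eventually_conj)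
    then have "eventually (\<lambda>p. fst p * snd p = mult_r (fst p) (snd p)) (nhds a \<times>\<^sub>F nhds b)"
      by (rule eventually_mono) (auto simp: mult_r_def)
    with lim[OF ab'] have "((\<lambda>p. mult_r (fst p) (snd p)) \<longlongrightarrow> a * b) (nhds a \<times>\<^sub>F nhds b)"
      by (rule Lim_transform_eventually)
    moreover have "mult_r a b = a * b"
      using ab by (auto simp: mult_r_def)
    ultimately show ?thesis
      by simp
  qed
  have "open {x. c < lower (h x) * lower (k x)}" for c
  proof (rule open_greater_mono2[where F = "(*)"])
    fix a b :: ennreal assume "c < a * b"
    then have "a \<noteq> 0" "b \<noteq> 0"
      by auto
    then show "((\<lambda>p. fst p * snd p) \<longlongrightarrow> a * b) (nhds a \<times>\<^sub>F nhds b)"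
      by (intro lim) simp_all
  qed (simp_all add: hk mult_mono)
  moreover have "open {x. mult_r (upper (h x)) (upper (k x)) < c}" for c
    by (rule open_less_mono2[where F = mult_r, OF mult_r_mono lim_r]) (simp_all add: hk)
  ultimately show ?thesis
    by (simp add: continuous_ivl_iff)
qed

section \<open>Continuous interval-valued valuations\<close>

typedef (overloaded) 'a lmap = "{h :: 'a::topological_space \<Rightarrow> IRp. continuous_on UNIV h}"
  morphisms lapp Lmap
  by (rule exI[of _ "\<lambda>_. 0"]) auto

setup_lifting type_definition_lmap

instantiation lmap :: (topological_space) "{order, plus}"
begin
lift_definition less_eq_lmap :: "'a lmap \<Rightarrow> 'a lmap \<Rightarrow> bool" is "\<lambda>h k. \<forall>x. h x \<le> k x" .
definition "h < k \<longleftrightarrow> h \<le> k \<and> \<not> k \<le> h" for h k :: "'a lmap"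
lift_definition plus_lmap :: "'a lmap \<Rightarrow> 'a lmap \<Rightarrow> 'a lmap" is "\<lambda>h k x. h x + k x"
  by (rule continuous_plus_ivl)
instance
proof
  fix h k l :: "'a lmap"
  show "h < k \<longleftrightarrow> h \<le> k \<and> \<not> k \<le> h"
    by (rule less_lmap_def)
  show "h \<le> h"
    by transfer simp
  show "h \<le> k \<Longrightarrow> k \<le> l \<Longrightarrow> h \<le> l"
    by transfer (metis order.trans)
  show "h \<le> k \<Longrightarrow> k \<le> h \<Longrightarrow> h = k"
    by transfer (simp add: fun_eq_iff order.antisym)
qed
end

lift_definition scale_lmap :: "IRp \<Rightarrow> 'a::topological_space lmap \<Rightarrow> 'a lmap"
  is "\<lambda>a h x. a \<odot> h x"
  by (intro continuous_times_ivl continuous_on_const)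

text \<open>The order on valuations is the pointwise order of the function type.\<close>
definition valuations :: "('a::topological_space lmap \<Rightarrow> IRp) set" where
  "valuations = {\<nu>. scott_continuous \<nu> \<and>
     (\<forall>a h. \<nu> (scale_lmap a h) = a \<odot> \<nu> h) \<and>
     (\<forall>h k. \<nu> (h + k) = \<nu> h + \<nu> k)}"

definition valuation_sup ::
    "('a::topological_space lmap \<Rightarrow> IRp) set \<Rightarrow> 'a lmap \<Rightarrow> IRp" where
  "valuation_sup D = (THE \<nu>. is_sup_in valuations D \<nu>)"

definition dirac :: "'a::topological_space \<Rightarrow> 'a lmap \<Rightarrow> IRp" where
  "dirac x h = lapp h x"

definition elementary :: "('a::topological_space lmap \<Rightarrow> IRp) set" where
  "elementary = {\<nu>. \<exists>(n::nat) r x. n \<ge> 1 \<and> \<nu> = (\<lambda>h. \<Sum>i=1..n. r i \<odot> dirac (x i) h)}"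

inductive_set minimal_valuations :: "('a::topological_space lmap \<Rightarrow> IRp) set" where
  elementary: "\<nu> \<in> elementary \<Longrightarrow> \<nu> \<in> minimal_valuations"
| directed_sup: "\<lbrakk>\<And>\<nu>. \<nu> \<in> D \<Longrightarrow> \<nu> \<in> minimal_valuations; directed D; is_sup_in valuations D \<mu>\<rbrakk>
    \<Longrightarrow> \<mu> \<in> minimal_valuations"

section \<open>The valuation associated with a Borel measure\<close>

definition support_of :: "'a measure \<Rightarrow> 'a set \<Rightarrow> bool" where
  "support_of \<mu> E \<longleftrightarrow> E \<subseteq> space \<mu> \<and>
     (\<forall>A\<in>sets \<mu>. \<forall>B\<in>sets \<mu>. A \<inter> E = B \<inter> E \<longrightarrow> emeasure \<mu> A = emeasure \<mu> B)"

text \<open>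
  The smallest closed support is guaranteed to exist for \<open>\<tau>\<close>-smooth Borel measures, in particular
  for every Borel measure on a second-countable space such as \<^typ>\<open>IR\<close>.
\<close>
definition supp :: "'a::topological_space measure \<Rightarrow> 'a set" where
  "supp \<mu> = (LEAST C. closed C \<and> support_of \<mu> C)"

definition saturated :: "'a::topological_space set \<Rightarrow> bool" where
  "saturated Q \<longleftrightarrow> (\<exists>\<U>. (\<forall>U\<in>\<U>. open U) \<and> Q = \<Inter>\<U>)"

definition lower_integral :: "'a measure \<Rightarrow> ('a \<Rightarrow> ennreal) \<Rightarrow> ennreal" where
  "lower_integral \<mu> f = (SUP r\<in>{0::real..}. \<integral>\<^sup>+ x. min (f x) (ennreal r) \<partial>\<mu>)"

definition bounded_wrt :: "'a::topological_space measure \<Rightarrow> ('a \<Rightarrow> ennreal) \<Rightarrow> bool" where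
  "bounded_wrt \<mu> f \<longleftrightarrow>
     (\<exists>Q. Q \<in> sets \<mu> \<and> compact Q \<and> saturated Q \<and> support_of \<mu> Q \<and>
          (SUP x \<in> Q \<inter> supp \<mu>. f x) < \<infinity>)"

text \<open>Only meaningful for upper semicontinuous \<open>f\<close>.\<close>
definition upper_integral :: "'a::topological_space measure \<Rightarrow> ('a \<Rightarrow> ennreal) \<Rightarrow> ennreal" where
  "upper_integral \<mu> f = (if bounded_wrt \<mu> f then lower_integral \<mu> f else \<infinity>)"

definition measure_valuation :: "'a::topological_space measure \<Rightarrow> 'a lmap \<Rightarrow> IRp" where
  "measure_valuation \<mu> h =
     Ivl (lower_integral \<mu> (\<lambda>x. lower (lapp h x)), upper_integral \<mu> (\<lambda>x. upper (lapp h x)))"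

lemma measure_valuation_well_formed:
  "lower_integral \<mu> (\<lambda>x. lower (lapp h x)) \<le> upper_integral \<mu> (\<lambda>x. upper (lapp h x))"
proof -
  have "lower_integral \<mu> (\<lambda>x. lower (lapp h x)) \<le> lower_integral \<mu> (\<lambda>x. upper (lapp h x))"
    unfolding lower_integral_def
    by (intro SUP_mono' nn_integral_mono min.mono lower_le_upper order_refl)
  then show ?thesis
    by (simp add: upper_integral_def)
qed

definition ivl_approximates :: "IRp \<Rightarrow> ennreal \<Rightarrow> bool" where
  "ivl_approximates I x \<longleftrightarrow> lower I \<le> x \<and> x \<le> upper I"

definition lmap_approximates ::
    "'a::topological_space lmap \<Rightarrow> ('a \<Rightarrow> ennreal) \<Rightarrow> bool" where
  "lmap_approximates h f \<longleftrightarrow> (\<forall>x. ivl_approximates (lapp h x) (f x))"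

definition approximates ::
    "('a::topological_space lmap \<Rightarrow> IRp) \<Rightarrow> 'a measure \<Rightarrow> bool" where
  "approximates \<nu> \<mu> \<longleftrightarrow>
     (\<forall>f\<in>borel_measurable \<mu>. \<forall>h. lmap_approximates h f \<longrightarrow>
        ivl_approximates (\<nu> h) (lower_integral \<mu> f))"

section \<open>Lebesgue measure on the unit interval\<close>

definition lebesgue01 :: "real measure" where
  "lebesgue01 = restrict_space lborel {0..1}"

definition point_ivl :: "real \<Rightarrow> IR" where
  "point_ivl x = Ivl (ereal x, ereal x)"

definition lebesgue_image :: "IR measure" where
  "lebesgue_image = distr lebesgue01 borel point_ivl"

lemma measurable_point_ivl: "point_ivl \<in> lebesgue01 \<rightarrow>\<^sub>M borel"
proof -
  have "continuous_on UNIV point_ivl"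
    unfolding continuous_ivl_iff point_ivl_def
    by (simp add: open_Collect_less continuous_on_ereal)
  then have "point_ivl \<in> borel_measurable lborel"
    using borel_measurable_continuous_onI by simp
  then show ?thesis
    unfolding lebesgue01_def by (rule measurable_restrict_space1)
qed

definition dyadic_valuation :: "nat \<Rightarrow> IR lmap \<Rightarrow> IRp" where
  "dyadic_valuation n =
     (\<lambda>h. \<Sum>i=1..2^n. Ivl (1 / 2^n, 1 / 2^n) \<odot>
            dirac (Ivl (ereal ((real i - 1) / 2^n), ereal (real i / 2^n))) h)"

definition lambda_bar :: "IR lmap \<Rightarrow> IRp" where
  "lambda_bar = valuation_sup (range dyadic_valuation)"

end

theory Submission
  imports Defs
begin

text \<open>
  A dyadic sum \<open>\<lambda>\<^sub>n(h)\<close> has as end-points the integrals over \<open>[0,1)\<close> of the step functions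
  \<open>x \<mapsto> h\<^sup>\<plusminus>(I\<^sub>n(x))\<close>, where \<open>I\<^sub>n(x)\<close> is the dyadic interval of level \<open>n\<close> around \<open>x\<close>.  As \<open>[x,x]\<close> is the
  directed supremum of the \<open>I\<^sub>n(x)\<close>, monotone convergence gives the left end-point of the supremum.
  On the right, decreasing convergence needs some \<open>\<lambda>\<^sub>n(h)\<^sup>+\<close> to be finite.  By compactness of \<open>[0,1]\<close>
  this happens iff \<open>h\<^sup>+\<close> is finite at all \<open>[x,x]\<close>, iff \<open>h\<^sup>+\<close> is bounded with respect to the image
  measure: a compact saturated support contains every \<open>[x,x]\<close>, and these form such a support.
\<close>

section \<open>Directed suprema of intervals\<close>

lemma is_sup_in_unique: "is_sup_in P D s \<Longrightarrow> is_sup_in P D t \<Longrightarrow> s = t"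
  unfolding is_sup_in_def by (meson order.antisym)

lemma directed_image:
  assumes "directed D" "mono f"
  shows "directed (f ` D)"
  using assms unfolding directed_def by (simp add: ball_simps bex_simps) (meson monoD)

lemma directed_range_incseq:
  fixes f :: "nat \<Rightarrow> 'a::order"
  assumes "incseq f"
  shows "directed (range f)"
  unfolding directed_def
proof (intro conjI ballI)
  fix a b assume "a \<in> range f" "b \<in> range f"
  then obtain m n where "a = f m" "b = f n"
    by blast
  then show "\<exists>c\<in>range f. a \<le> c \<and> b \<le> c"
    using assms by (intro bexI[of _ "f (max m n)"]) (auto intro: incseqD)
qed simp

text \<open>For directed families an interval supremum splits into a supremum of left end-points and
  an infimum of right end-points, so the later arguments can be carried out with scalars.\<close>

lemma is_sup_ivl_iff:
  fixes f :: "'i \<Rightarrow> 'a::complete_linorder ivl"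
  assumes "directed (f ` A)"
  shows "is_sup (f ` A) s \<longleftrightarrow>
    lower s = (SUP i\<in>A. lower (f i)) \<and> upper s = (INF i\<in>A. upper (f i))"
  using directed_ivl_bounds[OF assms, of s] is_sup_ivlI[of s "f ` A"] by (simp add: image_image) blast

text \<open>Two members have a common upper bound, so every left end-point lies below every right
  end-point and the limiting pair is again an interval.\<close>

lemma directed_ivl_sup_exists:
  fixes D :: "'a::complete_linorder ivl set"
  assumes D: "directed D"
  shows "\<exists>s. is_sup D s"
proof -
  have "lower I \<le> upper J" if IJ: "I \<in> D" "J \<in> D" for I J
    using directedD[OF D IJ] lower_le_upper by (metis less_eq_ivl_def order_trans)
  then have "(SUP I\<in>D. lower I) \<le> (INF I\<in>D. upper I)"
    by (intro SUP_least INF_greatest)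
  then show ?thesis
    by (intro exI[of _ "Ivl ((SUP I\<in>D. lower I), (INF I\<in>D. upper I))"] is_sup_ivlI) simp_all
qed

section \<open>Sums and products of directed families\<close>

lemma INF_add_const_ennreal:
  fixes f :: "'i \<Rightarrow> ennreal"
  assumes "A \<noteq> {}"
  shows "(INF i\<in>A. f i + c) = (INF i\<in>A. f i) + c"
  using continuous_at_Inf_mono[of "\<lambda>x. x + c" "f ` A"] assms
    continuous_add[of "at_right (Inf (f ` A))" "\<lambda>x. x" "\<lambda>x. c"]
  by (auto simp: mono_def image_comp)

text \<open>Directedness lets the diagonal sums \<open>f k + g k\<close> undercut all mixed sums
  \<open>f i + g j\<close>; the two infima are then pulled out one after the other as
  constants.\<close>

lemma INF_add_directed_ennreal:
  fixes f g :: "'i \<Rightarrow> ennreal"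
  assumes "A \<noteq> {}"
    and dir: "\<And>i j. i \<in> A \<Longrightarrow> j \<in> A \<Longrightarrow> \<exists>k\<in>A. f k + g k \<le> f i + g j"
  shows "(INF i\<in>A. f i + g i) = (INF i\<in>A. f i) + (INF i\<in>A. g i)"
proof (rule antisym)
  have "(INF i\<in>A. f i + g i) \<le> f i + (INF j\<in>A. g j)" if i: "i \<in> A" for i
    unfolding add.commute[of "f i"] INF_add_const_ennreal[OF \<open>A \<noteq> {}\<close>, symmetric]
    using dir[OF i] by (intro INF_greatest) (metis INF_lower2 add.commute)
  then show "(INF i\<in>A. f i + g i) \<le> (INF i\<in>A. f i) + (INF i\<in>A. g i)"
    unfolding INF_add_const_ennreal[OF \<open>A \<noteq> {}\<close>, symmetric] by (intro INF_greatest)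
qed (intro INF_greatest add_mono INF_lower)

text \<open>The two families must be directed jointly, with one index \<open>k\<close> serving both.
  The general index set allows use for families of maps as well as families of valuations.\<close>

lemma is_sup_plus_ivl:
  fixes f g :: "'i \<Rightarrow> IRp"
  assumes "A \<noteq> {}"
    and dir: "\<And>i j. i \<in> A \<Longrightarrow> j \<in> A \<Longrightarrow> \<exists>k\<in>A. f i \<le> f k \<and> g i \<le> g k \<and> f j \<le> f k \<and> g j \<le> g k"
    and s: "is_sup (f ` A) s" and t: "is_sup (g ` A) t"
  shows "is_sup ((\<lambda>i. f i + g i) ` A) (s + t)"
proof -
  have d: "directed (f ` A)" "directed (g ` A)"
    using dir \<open>A \<noteq> {}\<close> unfolding directed_def by (simp_all, blast+)
  have "(SUP i\<in>A. lower (f i) + lower (g i)) = (SUP i\<in>A. lower (f i)) + (SUP i\<in>A. lower (g i))"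
  proof (rule SUP_add_directed_ennreal)
    fix i j assume "i \<in> A" "j \<in> A"
    then show "\<exists>k\<in>A. lower (f i) + lower (g j) \<le> lower (f k) + lower (g k)"
      using dir[of i j] by (metis less_eq_ivl_def add_mono)
  qed
  moreover
  have "(INF i\<in>A. upper (f i) + upper (g i)) = (INF i\<in>A. upper (f i)) + (INF i\<in>A. upper (g i))"
  proof (rule INF_add_directed_ennreal[OF \<open>A \<noteq> {}\<close>])
    fix i j assume "i \<in> A" "j \<in> A"
    then show "\<exists>k\<in>A. upper (f k) + upper (g k) \<le> upper (f i) + upper (g j)"
      using dir[of i j] by (metis less_eq_ivl_def add_mono)
  qed
  ultimately show ?thesis
    using s t by (intro is_sup_ivlI) (simp_all add: is_sup_ivl_iff[OF d(1)] is_sup_ivl_iff[OF d(2)] image_image)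
qed

text \<open>The convention of \<open>mult_r\<close> is what makes this true at \<open>a = 0\<close>:
  the product is \<open>0\<close> at finite arguments and \<open>\<infinity>\<close> at
  \<open>\<infinity>\<close>, and an infimum is infinite only if all members are. At
  \<open>a = \<infinity>\<close> the product is constantly \<open>\<infinity>\<close>.\<close>

lemma mult_r_INF:
  assumes "A \<noteq> {}"
  shows "mult_r a (INF i\<in>A. f i) = (INF i\<in>A. mult_r a (f i))"
proof (rule antisym)
  show "mult_r a (INF i\<in>A. f i) \<le> (INF i\<in>A. mult_r a (f i))"
    by (intro INF_greatest mult_r_mono INF_lower) simp_all
  consider "a = 0" | "a = \<infinity>" | r where "0 < r" "a = ennreal r"
    by (cases a) (auto simp: less_le)
  then show "(INF i\<in>A. mult_r a (f i)) \<le> mult_r a (INF i\<in>A. f i)"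
  proof cases
    case 1
    show ?thesis
    proof (cases "(INF i\<in>A. f i) = \<infinity>")
      case False
      then obtain i where "i \<in> A" "f i \<noteq> \<infinity>"
        by (metis INF_eq_const assms infinity_ennreal_def)
      then show ?thesis
        using 1 by (intro INF_lower2[of i]) (auto simp: mult_r_def)
    qed (use 1 in \<open>simp add: mult_r_def\<close>)
  next
    case 2
    then show ?thesis
      by (auto simp: mult_r_def ennreal_top_mult)
  next
    case 3
    have eq: "mult_r a b = a * b" for b
      using 3 by (auto simp: mult_r_def)
    \<comment> \<open>Multiplication by a positive finite number is invertible, so the missing
      inequality follows by scaling back with the inverse.\<close>
    have inv: "ennreal (inverse r) * a = 1"
      using 3 by (simp add: ennreal_mult[symmetric])
    have "ennreal (inverse r) * (INF i\<in>A. a * f i) \<le> f i" if "i \<in> A" for i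
    proof -
      have "ennreal (inverse r) * (INF i\<in>A. a * f i) \<le> ennreal (inverse r) * (a * f i)"
        using that by (intro mult_left_mono INF_lower) simp_all
      also have "\<dots> = f i"
        by (simp add: mult.assoc[symmetric] inv)
      finally show ?thesis .
    qed
    then have "a * (ennreal (inverse r) * (INF i\<in>A. a * f i)) \<le> a * (INF i\<in>A. f i)"
      by (intro mult_left_mono INF_greatest) simp_all
    then show ?thesis
      using inv by (simp add: eq mult.assoc[symmetric] mult.commute[of a])
  qed
qed

lemma is_sup_times_ivl:
  fixes f :: "'i \<Rightarrow> IRp"
  assumes d: "directed (f ` A)" and s: "is_sup (f ` A) s"
  shows "is_sup ((\<lambda>i. a \<odot> f i) ` A) (a \<odot> s)"
proof -
  have "A \<noteq> {}"
    using d by (auto simp: directed_def)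
  then show ?thesis
    using s unfolding is_sup_ivl_iff[OF d]
    by (intro is_sup_ivlI) (simp_all add: image_image SUP_mult_left_ennreal mult_r_INF)
qed

section \<open>Suprema of continuous maps and of valuations\<close>

lemma is_sup_lmapI:
  assumes "\<And>x. is_sup ((\<lambda>h. lapp h x) ` D) (lapp s x)"
  shows "is_sup D s"
  using assms by (auto simp: is_sup_in_def less_eq_lmap.rep_eq)

lemma directed_lapp: "directed D \<Longrightarrow> directed ((\<lambda>h. lapp h x) ` D)"
  by (rule directed_image) (auto intro!: monoI simp: less_eq_lmap.rep_eq)

text \<open>The pointwise supremum \<open>t\<close> is itself continuous, since its defining open
  sets are unions of those of the members of \<open>D\<close>. It is therefore a supremum of maps,
  and uniqueness identifies it with \<open>s\<close>.\<close>

lemma is_sup_lmapD: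
  assumes D: "directed D" and s: "is_sup D s"
  shows "is_sup ((\<lambda>h. lapp h x) ` D) (lapp s x)"
proof -
  note dir = directed_lapp[OF D]
  obtain t where t: "is_sup ((\<lambda>h. lapp h x) ` D) (t x)" for x
    using directed_ivl_sup_exists[OF dir] by metis
  note t' = t[unfolded is_sup_ivl_iff[OF dir]]
  have cont: "continuous_on UNIV (lapp h)" for h :: "'a lmap"
    using lapp[of h] by simp
  have "open {x. c < lower (t x)}" for c
  proof -
    have "{x. c < lower (t x)} = (\<Union>h\<in>D. {x. c < lower (lapp h x)})"
      by (auto simp: t' less_SUP_iff)
    then show ?thesis
      using cont by (auto simp: continuous_ivl_iff)
  qed
  moreover have "open {x. upper (t x) < c}" for c
  proof -
    have "{x. upper (t x) < c} = (\<Union>h\<in>D. {x. upper (lapp h x) < c})"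
      by (auto simp: t' INF_less_iff)
    then show ?thesis
      using cont by (auto simp: continuous_ivl_iff)
  qed
  ultimately have "lapp (Lmap t) = t"
    by (intro Lmap_inverse) (simp add: continuous_ivl_iff)
  then have "is_sup D (Lmap t)"
    using t by (intro is_sup_lmapI) simp
  then show ?thesis
    using is_sup_in_unique[OF s] t \<open>lapp (Lmap t) = t\<close> by metis
qed

section \<open>Closure properties of the set of valuations\<close>

lemma valuationsD:
  assumes "\<nu> \<in> valuations"
  shows "mono \<nu>" "directed D \<Longrightarrow> is_sup D s \<Longrightarrow> is_sup (\<nu> ` D) (\<nu> s)"
    "\<nu> (scale_lmap a h) = a \<odot> \<nu> h" "\<nu> (h + k) = \<nu> h + \<nu> k"
  using assms by (auto simp: valuations_def scott_continuous_def)

lemma valuationsI: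
  assumes "mono \<nu>" "\<And>D s. directed D \<Longrightarrow> is_sup D s \<Longrightarrow> is_sup (\<nu> ` D) (\<nu> s)"
    "\<And>a h. \<nu> (scale_lmap a h) = a \<odot> \<nu> h" "\<And>h k. \<nu> (h + k) = \<nu> h + \<nu> k"
  shows "\<nu> \<in> valuations"
  using assms by (auto simp: valuations_def scott_continuous_def)

lemma mult_r_assoc: "mult_r (mult_r a b) c = mult_r a (mult_r b c)"
  by (cases a; cases b; cases c)
    (auto simp: mult_r_def mult.assoc ennreal_mult_eq_top_iff ennreal_top_mult ennreal_mult_top)

lemma mult_r_commute: "mult_r a b = mult_r b a"
  by (auto simp: mult_r_def mult.commute)

lemma mult_r_distrib: "mult_r a (b + c) = mult_r a b + mult_r a c"
  by (auto simp: mult_r_def distrib_left ennreal_mult_eq_top_iff ennreal_top_mult)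

lemma times_ivl_left_commute: "a \<odot> (b \<odot> c) = b \<odot> (a \<odot> c)"
  by (simp add: ivl_eq_iff mult.left_commute) (metis mult_r_assoc mult_r_commute)

lemma times_ivl_distrib: "a \<odot> (b + c) = a \<odot> b + a \<odot> c"
  by (simp add: ivl_eq_iff distrib_left mult_r_distrib)

lemma times_ivl_mono: "b \<le> c \<Longrightarrow> a \<odot> b \<le> a \<odot> c"
  by (simp add: less_eq_ivl_def mult_left_mono mult_r_mono)

lemma plus_ivl_mono: "a \<le> c \<Longrightarrow> b \<le> d \<Longrightarrow> a + b \<le> c + (d :: IRp)"
  by (simp add: less_eq_ivl_def add_mono)

lemma dirac_in_valuations: "dirac x \<in> valuations"
  by (rule valuationsI)
    (simp_all add: dirac_def mono_def less_eq_lmap.rep_eq scale_lmap.rep_eq plus_lmap.rep_eq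
      is_sup_lmapD)

lemma scale_in_valuations:
  assumes \<nu>: "\<nu> \<in> valuations"
  shows "(\<lambda>h. r \<odot> \<nu> h) \<in> valuations"
proof (rule valuationsI)
  show "mono (\<lambda>h. r \<odot> \<nu> h)"
    by (intro monoI times_ivl_mono monoD[OF valuationsD(1)[OF \<nu>]])
  show "is_sup ((\<lambda>h. r \<odot> \<nu> h) ` D) (r \<odot> \<nu> s)" if "directed D" "is_sup D s" for D s
    using that by (intro is_sup_times_ivl directed_image valuationsD(1,2)[OF \<nu>])
  show "r \<odot> \<nu> (scale_lmap a h) = a \<odot> (r \<odot> \<nu> h)" for a h
    by (simp add: valuationsD(3)[OF \<nu>] times_ivl_left_commute)
  show "r \<odot> \<nu> (h + k) = r \<odot> \<nu> h + r \<odot> \<nu> k" for h k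
    by (simp add: valuationsD(4)[OF \<nu>] times_ivl_distrib)
qed

lemma plus_in_valuations:
  assumes \<nu>: "\<nu> \<in> valuations" and \<mu>: "\<mu> \<in> valuations"
  shows "(\<lambda>h. \<nu> h + \<mu> h) \<in> valuations"
proof (rule valuationsI)
  note m = monoD[OF valuationsD(1)[OF \<nu>]] monoD[OF valuationsD(1)[OF \<mu>]]
  show "mono (\<lambda>h. \<nu> h + \<mu> h)"
    by (intro monoI plus_ivl_mono m)
  show "is_sup ((\<lambda>h. \<nu> h + \<mu> h) ` D) (\<nu> s + \<mu> s)" if D: "directed D" "is_sup D s" for D s
  proof (rule is_sup_plus_ivl)
    show "D \<noteq> {}"
      using D(1) by (auto simp: directed_def)
    show "\<exists>k\<in>D. \<nu> h \<le> \<nu> k \<and> \<mu> h \<le> \<mu> k \<and> \<nu> h' \<le> \<nu> k \<and> \<mu> h' \<le> \<mu> k" if "h \<in> D" "h' \<in> D" for h h'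
      using directedD[OF D(1) that] m by metis
  qed (intro valuationsD(2)[OF \<nu>] valuationsD(2)[OF \<mu>] D)+
  show "\<nu> (scale_lmap a h) + \<mu> (scale_lmap a h) = a \<odot> (\<nu> h + \<mu> h)" for a and h :: "'a lmap"
    by (simp add: valuationsD(3)[OF \<nu>] valuationsD(3)[OF \<mu>] times_ivl_distrib)
  show "\<nu> (h + k) + \<mu> (h + k) = \<nu> h + \<mu> h + (\<nu> k + \<mu> k)" for h k
    by (simp add: valuationsD(4)[OF \<nu>] valuationsD(4)[OF \<mu>] ac_simps)
qed

text \<open>The empty sum is excluded: since \<open>\<infinity> \<cdot>\<^sub>r 0 = \<infinity>\<close>, the zero map is not homogeneous.\<close>
lemma sum_in_valuations:
  assumes "finite A" "A \<noteq> {}" "\<And>i. i \<in> A \<Longrightarrow> \<nu> i \<in> valuations"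
  shows "(\<lambda>h. \<Sum>i\<in>A. \<nu> i h) \<in> valuations"
  using assms by (induction rule: finite_ne_induct) (simp_all add: plus_in_valuations)

lemma elementary_subset_valuations: "elementary \<subseteq> valuations"
  unfolding elementary_def
  by (auto intro!: sum_in_valuations scale_in_valuations dirac_in_valuations)

text \<open>Suprema commute with suprema, which gives Scott continuity; scaling and addition
  preserve directed suprema of intervals, which gives homogeneity and additivity. Hence suprema of
  valuations may be computed argument by argument.\<close>

lemma pointwise_sup_in_valuations:
  fixes \<mu> :: "'a::topological_space lmap \<Rightarrow> IRp"
  assumes V: "V \<subseteq> valuations" "directed V"
    and sup: "\<And>h. is_sup ((\<lambda>\<nu>. \<nu> h) ` V) (\<mu> h)"
  shows "is_sup_in valuations V \<mu>"
proof -
  have val: "\<nu> \<in> valuations" if "\<nu> \<in> V" for \<nu>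
    using V(1) that by blast
  have le: "\<nu> h \<le> \<mu> h" if "\<nu> \<in> V" for \<nu> and h :: "'a lmap"
    using sup[of h] that by (auto simp: is_sup_in_def)
  have least: "\<mu> h \<le> u" if "\<And>\<nu>. \<nu> \<in> V \<Longrightarrow> \<nu> h \<le> u" for u and h :: "'a lmap"
    using sup[of h] that by (auto simp: is_sup_in_def)
  have dir: "directed ((\<lambda>\<nu>. \<nu> h) ` V)" for h :: "'a lmap"
    using V(2) by (rule directed_image) (auto intro!: monoI simp: le_fun_def)
  have "\<mu> \<in> valuations"
  proof (rule valuationsI)
    show mono: "mono \<mu>"
    proof (intro monoI least)
      fix h k :: "'a lmap" and \<nu> assume "h \<le> k" "\<nu> \<in> V"
      then show "\<nu> h \<le> \<mu> k"
        using le[of \<nu> k] monoD[OF valuationsD(1)[OF val]] order_trans by blast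
    qed
    show "is_sup (\<mu> ` D) (\<mu> s)" if D: "directed D" "is_sup D s" for D s
      unfolding is_sup_in_def
    proof (intro conjI ballI impI)
      show "d \<le> \<mu> s" if "d \<in> \<mu> ` D" for d
        using that D(2) monoD[OF mono] by (auto simp: is_sup_in_def)
      fix u assume u: "\<forall>d\<in>\<mu> ` D. d \<le> u"
      show "\<mu> s \<le> u"
      \<comment> \<open>Exchange of suprema: a bound of \<open>\<mu>\<close> on \<open>D\<close>
        bounds each \<open>\<nu>\<close> on \<open>D\<close>, hence \<open>\<nu> s\<close> by Scott
        continuity of \<open>\<nu>\<close>.\<close>
      proof (rule least)
        fix \<nu> assume \<nu>: "\<nu> \<in> V"
        have "\<nu> h \<le> u" if "h \<in> D" for h
          using le[OF \<nu>, of h] u that by (auto intro: order_trans)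
        then show "\<nu> s \<le> u"
          using valuationsD(2)[OF val[OF \<nu>] D] by (auto simp: is_sup_in_def)
      qed
    qed simp
    show "\<mu> (scale_lmap a h) = a \<odot> \<mu> h" for a and h :: "'a lmap"
    proof (rule is_sup_in_unique[OF sup])
      have "(\<lambda>\<nu>. \<nu> (scale_lmap a h)) ` V = (\<lambda>\<nu>. a \<odot> \<nu> h) ` V"
        using val by (intro image_cong) (auto simp: valuationsD(3))
      then show "is_sup ((\<lambda>\<nu>. \<nu> (scale_lmap a h)) ` V) (a \<odot> \<mu> h)"
        using is_sup_times_ivl[OF dir sup] by metis
    qed
    show "\<mu> (h + k) = \<mu> h + \<mu> k" for h k :: "'a lmap"
    proof (rule is_sup_in_unique[OF sup])
      have "(\<lambda>\<nu>. \<nu> (h + k)) ` V = (\<lambda>\<nu>. \<nu> h + \<nu> k) ` V"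
        using val by (intro image_cong) (auto simp: valuationsD(4))
      moreover have "is_sup ((\<lambda>\<nu>. \<nu> h + \<nu> k) ` V) (\<mu> h + \<mu> k)"
      proof (rule is_sup_plus_ivl[OF _ _ sup sup])
        show "V \<noteq> {}"
          using V(2) by (auto simp: directed_def)
        show "\<exists>\<kappa>\<in>V. \<nu> h \<le> \<kappa> h \<and> \<nu> k \<le> \<kappa> k \<and> \<nu>' h \<le> \<kappa> h \<and> \<nu>' k \<le> \<kappa> k"
          if "\<nu> \<in> V" "\<nu>' \<in> V" for \<nu> \<nu>'
          using directedD[OF V(2) that] by (metis le_funD)
      qed
      ultimately show "is_sup ((\<lambda>\<nu>. \<nu> (h + k)) ` V) (\<mu> h + \<mu> k)"
        by simp
    qed
  qed
  then show ?thesis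
    using le least by (auto simp: is_sup_in_def le_fun_def)
qed

section \<open>Continuous maps on an interval domain\<close>

lemma open_lmap:
  shows open_lower_lmap: "open {x. c < lower (lapp h x)}"
    and open_upper_lmap: "open {x. upper (lapp h x) < c}"
  using lapp[of h] by (simp_all add: continuous_ivl_iff)

lemma lapp_Lmap_ivl:
  fixes f :: "'a::topological_space \<Rightarrow> IRp"
  assumes "\<And>c. open {x. c < lower (f x)}" "\<And>c. open {x. upper (f x) < c}"
  shows "lapp (Lmap f) = f"
  using assms by (intro Lmap_inverse) (simp add: continuous_ivl_iff)

lemma borel_measurable_lmap [measurable]:
  fixes h :: "'a::topological_space lmap"
  shows "(\<lambda>x. lower (lapp h x)) \<in> borel_measurable borel"
    and "(\<lambda>x. upper (lapp h x)) \<in> borel_measurable borel"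
  by (rule borel_measurableI_greater, simp add: open_lmap)
    (rule borel_measurableI_less, simp add: open_lmap)

text \<open>Scott-open sets are upper sets. If an end-point at \<open>J\<close> were worse than at
  \<open>I\<close>, the open set cut off at the value at \<open>J\<close> would contain
  \<open>I\<close> but not \<open>J\<close>.\<close>

lemma mono_lapp:
  fixes h :: "'a::order ivl lmap"
  shows "mono (lapp h)"
proof (rule monoI)
  fix I J :: "'a ivl" assume "I \<le> J"
  then have up: "J \<in> U" if "open U" "I \<in> U" for U
    using that scott_openD(1) by (auto simp: open_ivl_def)
  have "lower (lapp h I) \<le> lower (lapp h J)"
    using up[OF open_lower_lmap, of "lower (lapp h J)" h] by (simp, meson leI less_irrefl)
  moreover have "upper (lapp h J) \<le> upper (lapp h I)"
    using up[OF open_upper_lmap, of h "upper (lapp h J)"] by (simp, meson leI less_irrefl)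
  ultimately show "lapp h I \<le> lapp h J"
    by (simp add: less_eq_ivl_def)
qed

text \<open>Topological continuity implies preservation of directed suprema: an open set around
  \<open>s\<close> meets \<open>D\<close>. The threshold is the supremum (or infimum) over
  \<open>D\<close> itself, which no member of \<open>D\<close> can pass.\<close>

lemma lapp_is_sup:
  fixes h :: "'a::order ivl lmap"
  assumes D: "directed D" "is_sup D s"
  shows "is_sup (lapp h ` D) (lapp h s)"
proof -
  have le: "lapp h d \<le> lapp h s" if "d \<in> D" for d
    using D(2) that monoD[OF mono_lapp] by (auto simp: is_sup_in_def)
  have meet: "\<exists>d\<in>D. d \<in> U" if "open U" "s \<in> U" for U
    using that scott_openD(2)[OF _ D] by (simp add: open_ivl_def)
  have "lower (lapp h s) \<le> (SUP d\<in>D. lower (lapp h d))"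
  proof (rule ccontr)
    assume "\<not> ?thesis"
    then obtain d where "d \<in> D" "(SUP d\<in>D. lower (lapp h d)) < lower (lapp h d)"
      using meet[OF open_lower_lmap] by force
    then show False
      by (metis SUP_upper leD)
  qed
  moreover have "(INF d\<in>D. upper (lapp h d)) \<le> upper (lapp h s)"
  proof (rule ccontr)
    assume "\<not> ?thesis"
    then obtain d where "d \<in> D" "upper (lapp h d) < (INF d\<in>D. upper (lapp h d))"
      using meet[OF open_upper_lmap] by force
    then show False
      by (metis INF_lower leD)
  qed
  ultimately show ?thesis
    using le by (intro is_sup_ivlI antisym)
      (auto simp: image_image less_eq_ivl_def intro: SUP_least INF_greatest)
qed

section \<open>Closed, measurable and saturated sets of intervals\<close>

lemma closed_lower_le: "closed {I :: 'a::complete_linorder ivl. lower I \<le> c}"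
  using open_lower_greater[of c] by (simp add: closed_def Collect_neg_eq[symmetric] not_le)

lemma closed_upper_ge: "closed {I :: 'a::complete_linorder ivl. c \<le> upper I}"
  using open_upper_less[of c] by (simp add: closed_def Collect_neg_eq[symmetric] not_le)

lemma borel_measurable_ivl_bounds [measurable]:
  "(lower :: IR \<Rightarrow> ereal) \<in> borel_measurable borel"
  "(upper :: IR \<Rightarrow> ereal) \<in> borel_measurable borel"
  by (rule borel_measurableI_greater, simp add: open_lower_greater)
    (rule borel_measurableI_less, simp add: open_upper_less)

text \<open>The complement of a principal lower set is open, and an upper set is the intersection of
  these complements over all \<open>J\<close> outside it.\<close>

lemma saturated_up_closed:
  fixes Q :: "'a::complete_linorder ivl set"
  assumes up: "\<And>I J. I \<in> Q \<Longrightarrow> I \<le> J \<Longrightarrow> J \<in> Q"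
  shows "saturated Q"
proof -
  have "open {I. \<not> I \<le> J}" for J :: "'a ivl"
  proof -
    have "{I. \<not> I \<le> J} = {I. lower J < lower I} \<union> {I. upper I < upper J}"
      by (auto simp: less_eq_ivl_def not_le)
    then show ?thesis
      by (simp add: open_lower_greater open_upper_less open_Un)
  qed
  moreover have "Q = \<Inter> ((\<lambda>J. {I. \<not> I \<le> J}) ` (- Q))"
    using up by auto
  ultimately show ?thesis
    unfolding saturated_def by (intro exI[of _ "(\<lambda>J. {I. \<not> I \<le> J}) ` (- Q)"]) auto
qed

lemma saturatedD:
  fixes Q :: "'a::order ivl set"
  assumes "saturated Q" "I \<in> Q" "I \<le> J"
  shows "J \<in> Q"
  using assms unfolding saturated_def open_ivl_def by (auto dest: scott_openD(1))

section \<open>Dyadic intervals\<close>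

definition dyadic_ivl :: "nat \<Rightarrow> nat \<Rightarrow> IR" where
  "dyadic_ivl n i = Ivl (ereal ((real i - 1) / 2^n), ereal (real i / 2^n))"

text \<open>The floor selects the half-open cell around \<open>x\<close>, of which the closure is
  taken. At \<open>x = 1\<close> this cell starts at \<open>1\<close> and is none of the intervals
  in the dyadic sum, so integrals are later taken over \<open>{0..<1}\<close>.\<close>

definition dyadic_cell :: "nat \<Rightarrow> real \<Rightarrow> IR" where
  "dyadic_cell n x = Ivl (ereal (\<lfloor>2^n * x\<rfloor> / 2^n), ereal ((\<lfloor>2^n * x\<rfloor> + 1) / 2^n))"

lemma bounds_point_ivl [simp]: "lower (point_ivl x) = x" "upper (point_ivl x) = x"
  by (simp_all add: point_ivl_def)

lemma bounds_dyadic_ivl [simp]: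
  "lower (dyadic_ivl n i) = ereal ((real i - 1) / 2^n)" "upper (dyadic_ivl n i) = ereal (real i / 2^n)"
  by (simp_all add: dyadic_ivl_def divide_right_mono)

lemma bounds_dyadic_cell [simp]:
  "lower (dyadic_cell n x) = ereal (\<lfloor>2^n * x\<rfloor> / 2^n)"
  "upper (dyadic_cell n x) = ereal ((\<lfloor>2^n * x\<rfloor> + 1) / 2^n)"
  by (simp_all add: dyadic_cell_def divide_right_mono)

text \<open>Doubling a number with floor \<open>k\<close> gives floor \<open>2 * k\<close> or
  \<open>2 * k + 1\<close>, so the next cell is one of the two halves.\<close>

lemma incseq_dyadic_cell: "incseq (\<lambda>n. dyadic_cell n x)"
proof (rule incseq_SucI)
  fix n
  define k m where "k = \<lfloor>2^n * x\<rfloor>" and "m = \<lfloor>2^Suc n * x\<rfloor>"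
  have m: "m = \<lfloor>2 * (2^n * x)\<rfloor>"
    by (simp add: m_def mult.assoc)
  have "2 * k \<le> m"
    unfolding k_def m by linarith
  moreover have "m < 2 * (k + 1)"
    unfolding m floor_less_iff k_def by (simp, linarith)
  ultimately have "2 * k \<le> m" "m + 1 \<le> 2 * (k + 1)"
    by simp_all
  then have "real_of_int (2 * k) \<le> m" "real_of_int (m + 1) \<le> real_of_int (2 * (k + 1))"
    by (simp_all only: of_int_le_iff)
  then have "2 * real_of_int k / 2^Suc n \<le> m / 2^Suc n"
    "(real_of_int m + 1) / 2^Suc n \<le> 2 * (real_of_int k + 1) / 2^Suc n"
    "2 * (real_of_int k + 1) / 2^Suc n = (real_of_int k + 1) / 2^n"
    by (intro divide_right_mono; simp)+ (simp add: field_simps)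
  then show "dyadic_cell n x \<le> dyadic_cell (Suc n) x"
    unfolding less_eq_ivl_def bounds_dyadic_cell k_def[symmetric] m_def[symmetric] by (simp del: distrib_left_numeral)
qed

lemma tendsto_dyadic_floor:
  shows "(\<lambda>n. \<lfloor>2^n * x\<rfloor> / 2^n) \<longlonglongrightarrow> x"
    and "(\<lambda>n. (\<lfloor>2^n * x\<rfloor> + 1) / 2^n) \<longlonglongrightarrow> x"
proof -
  have pow: "(\<lambda>n. 1 / 2^n) \<longlonglongrightarrow> (0::real)"
    using LIMSEQ_realpow_zero[of "1/2"] by (simp add: power_one_over)
  show lim: "(\<lambda>n. \<lfloor>2^n * x\<rfloor> / 2^n) \<longlonglongrightarrow> x"
  proof (rule tendsto_sandwich[OF _ _ _ tendsto_const])
    show "(\<lambda>n. x - 1 / 2^n) \<longlonglongrightarrow> x"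
      using tendsto_diff[OF tendsto_const pow] unfolding diff_zero .
    show "\<forall>\<^sub>F n in sequentially. x - 1 / 2^n \<le> \<lfloor>2^n * x\<rfloor> / 2^n"
    proof (intro always_eventually allI)
      fix n
      have "x - 1 / 2^n = (2^n * x - 1) / 2^n"
        by (simp add: diff_divide_distrib)
      also have "\<dots> \<le> \<lfloor>2^n * x\<rfloor> / 2^n"
        by (rule divide_right_mono[OF real_of_int_floor_ge_diff_one]) simp
      finally show "x - 1 / 2^n \<le> \<lfloor>2^n * x\<rfloor> / 2^n" .
    qed
    show "\<forall>\<^sub>F n in sequentially. \<lfloor>2^n * x\<rfloor> / 2^n \<le> x"
      by (simp add: pos_divide_le_eq mult.commute[of x])
  qed
  show "(\<lambda>n. (\<lfloor>2^n * x\<rfloor> + 1) / 2^n) \<longlonglongrightarrow> x"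
    using tendsto_add[OF lim pow] by (simp add: add_divide_distrib)
qed

lemma is_sup_dyadic_cell: "is_sup (range (\<lambda>n. dyadic_cell n x)) (point_ivl x)"
proof (rule is_sup_ivlI)
  have mono: "incseq (\<lambda>n. lower (dyadic_cell n x))" "decseq (\<lambda>n. upper (dyadic_cell n x))"
    using incseq_dyadic_cell[of x] unfolding incseq_def decseq_def less_eq_ivl_def by blast+
  have "(\<lambda>n. lower (dyadic_cell n x)) \<longlonglongrightarrow> lower (point_ivl x)"
    using tendsto_dyadic_floor(1) by simp
  from LIMSEQ_unique[OF this LIMSEQ_SUP[OF mono(1)]]
  show "lower (point_ivl x) = (SUP I\<in>range (\<lambda>n. dyadic_cell n x). lower I)"
    by (simp only: image_image)
  have "(\<lambda>n. upper (dyadic_cell n x)) \<longlonglongrightarrow> upper (point_ivl x)"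
    using tendsto_dyadic_floor(2) by simp
  from LIMSEQ_unique[OF this LIMSEQ_INF[OF mono(2)]]
  show "upper (point_ivl x) = (INF I\<in>range (\<lambda>n. dyadic_cell n x). upper I)"
    by (simp only: image_image)
qed

text \<open>Continuous maps preserve the directed supremum of the cells; this supplies the pointwise
  limits for the convergence theorems.\<close>

lemma lapp_point_ivl:
  shows lower_lapp_point_ivl: "lower (lapp h (point_ivl x)) = (SUP n. lower (lapp h (dyadic_cell n x)))"
    and upper_lapp_point_ivl: "upper (lapp h (point_ivl x)) = (INF n. upper (lapp h (dyadic_cell n x)))"
  using directed_ivl_bounds[OF directed_image[OF directed_range_incseq mono_lapp]
      lapp_is_sup[OF directed_range_incseq is_sup_dyadic_cell],
      OF incseq_dyadic_cell incseq_dyadic_cell, of h x]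
  by (simp_all add: image_image)

lemma dyadic_cell_eq_iff:
  assumes "i \<ge> 1"
  shows "\<lfloor>2^n * x\<rfloor> = int i - 1 \<longleftrightarrow> x \<in> {(real i - 1) / 2^n ..< real i / 2^n}"
proof -
  have "x \<in> {(real i - 1) / 2^n ..< real i / 2^n} \<longleftrightarrow> real i - 1 \<le> 2^n * x \<and> 2^n * x < real i"
    by (simp add: pos_divide_le_eq pos_less_divide_eq mult.commute)
  then show ?thesis
    using assms by (simp add: floor_eq_iff of_nat_diff)
qed

text \<open>Adding one turns the zero-based floor into the one-based summation index; for negative
  \<open>x\<close>, \<open>nat\<close> returns \<open>0\<close>, which is out of range.\<close>

lemma dyadic_index: "x \<in> {0..<1} \<longleftrightarrow> nat (\<lfloor>2^n * x\<rfloor> + 1) \<in> {1..2^n}"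
proof -
  have "x \<in> {0..<1} \<longleftrightarrow> 0 \<le> \<lfloor>2^n * x\<rfloor> \<and> \<lfloor>2^n * x\<rfloor> < 2^n"
    using mult_le_cancel_left_pos[of "2^n" 0 x] by (simp add: floor_less_iff)
  also have "\<dots> \<longleftrightarrow> nat (\<lfloor>2^n * x\<rfloor> + 1) \<in> {1..2^n}"
    by (auto simp: nat_le_iff Suc_le_eq simp del: zero_le_floor)
  finally show ?thesis .
qed

text \<open>The half-open pieces partition \<open>{0..<1}\<close>, so exactly one summand survives.
  This exhibits the left side as a step function for arbitrary \<open>F\<close>, and so as a
  measurable function.\<close>

lemma dyadic_cell_step:
  fixes F :: "IR \<Rightarrow> ennreal"
  shows "F (dyadic_cell n x) * indicator {0..<1} x =
    (\<Sum>i=1..2^n. F (dyadic_ivl n i) * indicator {(real i - 1) / 2^n ..< real i / 2^n} x)"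
proof -
  have eq: "F (dyadic_ivl n i) * indicator {(real i - 1) / 2^n ..< real i / 2^n} x =
      (if i = nat (\<lfloor>2^n * x\<rfloor> + 1) then F (dyadic_cell n x) else 0)" if "i \<in> {1..2^n}" for i
    using that dyadic_cell_eq_iff[of i n x]
    by (auto simp: indicator_def dyadic_ivl_def dyadic_cell_def)
  have "(\<Sum>i=1..2^n. F (dyadic_ivl n i) * indicator {(real i - 1) / 2^n ..< real i / 2^n} x) =
      (\<Sum>i=1..2^n. if i = nat (\<lfloor>2^n * x\<rfloor> + 1) then F (dyadic_cell n x) else 0)"
    by (intro sum.cong refl eq)
  also have "\<dots> = (if x \<in> {0..<1} then F (dyadic_cell n x) else 0)"
    unfolding dyadic_index[of x n] by (rule sum.delta) simp
  finally show ?thesis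
    by (simp add: indicator_def)
qed

section \<open>Integration against the image of Lebesgue measure\<close>

text \<open>The point \<open>1\<close> is a null set; dropping it leaves the half-open domain that
  the dyadic cells partition.\<close>

lemma nn_integral_lebesgue_image:
  assumes [measurable]: "f \<in> borel_measurable borel"
  shows "(\<integral>\<^sup>+I. f I \<partial>lebesgue_image) = (\<integral>\<^sup>+x. f (point_ivl x) * indicator {0..<1} x \<partial>lborel)"
proof -
  have "(\<integral>\<^sup>+I. f I \<partial>lebesgue_image) = (\<integral>\<^sup>+x. f (point_ivl x) \<partial>lebesgue01)"
    unfolding lebesgue_image_def by (intro nn_integral_distr measurable_point_ivl) simp
  also have "\<dots> = (\<integral>\<^sup>+x. f (point_ivl x) * indicator {0..1} x \<partial>lborel)"
    unfolding lebesgue01_def by (intro nn_integral_restrict_space) simp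
  also have "\<dots> = (\<integral>\<^sup>+x. f (point_ivl x) * indicator {0..<1} x \<partial>lborel)"
    using AE_lborel_singleton[of 1] by (intro nn_integral_cong_AE) (auto simp: indicator_def elim!: eventually_mono)
  finally show ?thesis .
qed

lemma sets_lebesgue_image [simp, measurable_cong]: "sets lebesgue_image = sets borel"
  by (simp add: lebesgue_image_def)

lemma space_lebesgue_image [simp]: "space lebesgue_image = UNIV"
  by (simp add: lebesgue_image_def)

lemma emeasure_lebesgue_image:
  assumes "A \<in> sets borel"
  shows "emeasure lebesgue_image A = emeasure lborel {x\<in>{0..1}. point_ivl x \<in> A}"
proof -
  have "emeasure lebesgue_image A = emeasure lebesgue01 (point_ivl -` A \<inter> {0..1})"
    using assms emeasure_distr[OF measurable_point_ivl assms]
    by (simp add: lebesgue_image_def) (simp add: lebesgue01_def space_restrict_space)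
  also have "\<dots> = emeasure lborel (point_ivl -` A \<inter> {0..1})"
    unfolding lebesgue01_def by (rule emeasure_restrict_space) auto
  also have "point_ivl -` A \<inter> {0..1} = {x\<in>{0..1}. point_ivl x \<in> A}"
    by auto
  finally show ?thesis .
qed

lemma continuous_on_point_ivl: "continuous_on UNIV point_ivl"
  unfolding continuous_ivl_iff by (simp add: open_Collect_less continuous_on_ereal)

text \<open>The part of \<open>{0..1}\<close> within distance \<open>e\<close> of \<open>x\<close>
  contains a nonempty open interval, also when \<open>x\<close> is an end-point.\<close>

lemma emeasure_lebesgue_image_pos:
  assumes A: "A \<in> sets borel" and x: "x \<in> {0..1}" and "e > 0"
    and near: "\<And>y. y \<in> {0..1} \<Longrightarrow> \<bar>y - x\<bar> < e \<Longrightarrow> point_ivl y \<in> A"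
  shows "emeasure lebesgue_image A > 0"
proof -
  let ?a = "max 0 (x - e)" and ?b = "min 1 (x + e)"
  have [measurable]: "point_ivl \<in> borel_measurable lborel"
    using borel_measurable_continuous_onI[OF continuous_on_point_ivl] by simp
  have "0 < ?b - ?a"
    using x \<open>e > 0\<close> by auto
  then have "0 < emeasure lborel {?a<..<?b}"
    by simp
  also have "\<dots> \<le> emeasure lborel {x\<in>{0..1}. point_ivl x \<in> A}"
    using near A by (intro emeasure_mono) (auto simp: abs_if)
  also have "\<dots> = emeasure lebesgue_image A"
    by (rule emeasure_lebesgue_image[OF A, symmetric])
  finally show ?thesis .
qed

text \<open>Monotone convergence along truncation at the natural numbers, which are cofinal among
  the real truncation levels.\<close>

lemma lower_integral_eq:
  assumes [measurable]: "f \<in> borel_measurable \<mu>"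
  shows "lower_integral \<mu> f = (\<integral>\<^sup>+x. f x \<partial>\<mu>)"
proof (rule antisym)
  show "lower_integral \<mu> f \<le> (\<integral>\<^sup>+x. f x \<partial>\<mu>)"
    unfolding lower_integral_def by (intro SUP_least nn_integral_mono) simp
  have "f x = (SUP n::nat. min (f x) (ennreal (real n)))" for x
  proof (rule antisym)
    show "f x \<le> (SUP n::nat. min (f x) (ennreal (real n)))"
    proof (cases "f x")
      case (real q)
      obtain n :: nat where "q \<le> real n"
        using real_arch_simple by blast
      then show ?thesis
        using real by (intro SUP_upper2[of n]) (simp_all add: min_def ennreal_leI)
    next
      case top
      then show ?thesis
        using ennreal_SUP_of_nat_eq_top by (simp add: ennreal_of_nat_eq_real_of_nat min_def top_unique)
    qed
  qed (simp add: SUP_least)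
  then have "(\<integral>\<^sup>+x. f x \<partial>\<mu>) = (\<integral>\<^sup>+x. (SUP n::nat. min (f x) (ennreal (real n))) \<partial>\<mu>)"
    by simp
  also have "\<dots> = (SUP n::nat. \<integral>\<^sup>+x. min (f x) (ennreal (real n)) \<partial>\<mu>)"
    by (intro nn_integral_monotone_convergence_SUP)
      (simp_all add: incseq_def le_fun_def min.coboundedI2 ennreal_leI)
  also have "\<dots> \<le> lower_integral \<mu> f"
    unfolding lower_integral_def by (intro SUP_least SUP_upper) simp
  finally show "(\<integral>\<^sup>+x. f x \<partial>\<mu>) \<le> lower_integral \<mu> f" .
qed

lemma lower_integral_mono:
  "(\<And>x. f x \<le> g x) \<Longrightarrow> lower_integral \<mu> f \<le> lower_integral \<mu> g"
  unfolding lower_integral_def by (intro SUP_mono' nn_integral_mono min.mono order_refl)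

section \<open>Dyadic valuations as integrals of step functions\<close>

lemma lower_zero_ivl [simp]: "lower (0 :: 'a::ordered_comm_monoid_add ivl) = 0"
  and upper_zero_ivl [simp]: "upper (0 :: 'a::ordered_comm_monoid_add ivl) = 0"
  by (transfer, simp)+

lemma lower_sum_ivl: "lower (\<Sum>i\<in>A. f i) = (\<Sum>i\<in>A. lower (f i))"
  and upper_sum_ivl: "upper (\<Sum>i\<in>A. f i) = (\<Sum>i\<in>A. upper (f i))"
  by (induction A rule: infinite_finite_induct; simp)+

lemma ennreal_inverse_pow2: "1 / 2^n = ennreal (1 / 2^n)"
  by (simp add: divide_ennreal[symmetric] ennreal_power[symmetric])

text \<open>The weight is positive and finite, so the exceptional cases of \<open>mult_r\<close>
  differ from the usual product in no value.\<close>

lemma mult_r_inverse_pow2: "mult_r (1 / 2^n) b = 1 / 2^n * b"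
  unfolding ennreal_inverse_pow2 by (simp add: mult_r_def ennreal_top_eq_mult_iff)

lemma dyadic_valuation_eq:
  "dyadic_valuation n h = (\<Sum>i=1..2^n. Ivl (1 / 2^n, 1 / 2^n) \<odot> dirac (dyadic_ivl n i) h)"
  by (simp add: dyadic_valuation_def dyadic_ivl_def)

lemma borel_measurable_dyadic_cell:
  fixes F :: "IR \<Rightarrow> ennreal"
  shows "(\<lambda>x. F (dyadic_cell n x) * indicator {0..<1} x) \<in> borel_measurable lborel"
  unfolding dyadic_cell_step by measurable

lemma nn_integral_dyadic_cell:
  fixes F :: "IR \<Rightarrow> ennreal"
  shows "(\<integral>\<^sup>+x. F (dyadic_cell n x) * indicator {0..<1} x \<partial>lborel) =
    (\<Sum>i=1..2^n. 1 / 2^n * F (dyadic_ivl n i))"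
proof -
  have len: "emeasure lborel {(real i - 1) / 2^n ..< real i / 2^n} = 1 / 2^n" for i
    by (simp add: divide_right_mono ennreal_inverse_pow2 diff_divide_distrib)
  show ?thesis
    unfolding dyadic_cell_step
    by (subst nn_integral_sum) (simp_all add: nn_integral_cmult_indicator len mult.commute)
qed

lemma bounds_dyadic_valuation:
  shows lower_dyadic_valuation: "lower (dyadic_valuation n h) =
      (\<integral>\<^sup>+x. lower (lapp h (dyadic_cell n x)) * indicator {0..<1} x \<partial>lborel)"
    and upper_dyadic_valuation: "upper (dyadic_valuation n h) =
      (\<integral>\<^sup>+x. upper (lapp h (dyadic_cell n x)) * indicator {0..<1} x \<partial>lborel)"
  unfolding nn_integral_dyadic_cell[of "\<lambda>I. lower (lapp h I)"]
    nn_integral_dyadic_cell[of "\<lambda>I. upper (lapp h I)"] dyadic_valuation_eq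
  by (simp_all add: lower_sum_ivl upper_sum_ivl dirac_def mult_r_inverse_pow2)

lemma lapp_dyadic_cell_mono:
  assumes "m \<le> n"
  shows "lower (lapp h (dyadic_cell m x)) \<le> lower (lapp h (dyadic_cell n x))"
    and "upper (lapp h (dyadic_cell n x)) \<le> upper (lapp h (dyadic_cell m x))"
  using monoD[OF mono_lapp incseqD[OF incseq_dyadic_cell assms], of h x]
  by (simp_all add: less_eq_ivl_def)

text \<open>In integral form the refinement of cells is a pointwise comparison of integrands, so no
  sum has to be split.\<close>

lemma incseq_dyadic_valuation: "incseq dyadic_valuation"
  unfolding incseq_def le_fun_def less_eq_ivl_def bounds_dyadic_valuation
  by (intro allI impI conjI nn_integral_mono mult_right_mono lapp_dyadic_cell_mono) simp_all

lemma dyadic_valuation_elementary: "dyadic_valuation n \<in> elementary"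
  unfolding elementary_def dyadic_valuation_def
  by (intro CollectI exI[of _ "2^n"] exI[of _ "\<lambda>i. Ivl (1 / 2^n, 1 / 2^n)"]
      exI[of _ "\<lambda>i. Ivl (ereal ((real i - 1) / 2^n), ereal (real i / 2^n))"]) simp

text \<open>A finite sum with positive finite weights is finite exactly when all its terms
  are.\<close>

lemma upper_dyadic_valuation_finite_iff:
  "upper (dyadic_valuation n h) < \<infinity> \<longleftrightarrow> (\<forall>i\<in>{1..2^n}. upper (lapp h (dyadic_ivl n i)) < \<infinity>)"
  unfolding upper_dyadic_valuation nn_integral_dyadic_cell[of "\<lambda>I. upper (lapp h I)"]
  by (auto simp: ennreal_inverse_pow2 ennreal_mult_less_top)

section \<open>Supports of the image measure\<close>

lemma support_of_point_ivls: "support_of lebesgue_image (point_ivl ` {0..1})"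
  unfolding support_of_def
proof (intro conjI ballI impI)
  fix A B assume AB: "A \<in> sets lebesgue_image" "B \<in> sets lebesgue_image"
    "A \<inter> point_ivl ` {0..1} = B \<inter> point_ivl ` {0..1}"
  then have "{x\<in>{0..1}. point_ivl x \<in> A} = {x\<in>{0..1}. point_ivl x \<in> B}"
    by blast
  then show "emeasure lebesgue_image A = emeasure lebesgue_image B"
    using AB(1,2) by (simp add: emeasure_lebesgue_image)
qed simp

lemma support_of_mono: "support_of \<mu> E \<Longrightarrow> E \<subseteq> F \<Longrightarrow> F \<subseteq> space \<mu> \<Longrightarrow> support_of \<mu> F"
  unfolding support_of_def by blast

lemma support_of_compl:
  assumes "support_of \<mu> E" "A \<in> sets \<mu>" "A \<inter> E = {}"
  shows "emeasure \<mu> A = 0"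
proof -
  have "emeasure \<mu> A = emeasure \<mu> {}"
    using assms unfolding support_of_def by blast
  then show ?thesis
    by simp
qed

text \<open>Replaces the box bounds, which may be infinite, by one positive real radius.\<close>

lemma open_point_ivl_nhd:
  assumes "open U" "point_ivl x \<in> U"
  obtains e where "e > 0" "\<And>I. ereal (x - e) < lower I \<Longrightarrow> upper I < ereal (x + e) \<Longrightarrow> I \<in> U"
proof -
  obtain a b where ab: "a = bot \<or> a < ereal x" "b = top \<or> ereal x < b"
    "\<And>I. (a = bot \<or> a < lower I) \<Longrightarrow> (b = top \<or> upper I < b) \<Longrightarrow> I \<in> U"
    using open_ivl_box[OF assms] by (metis bounds_point_ivl)
  have "\<exists>e>0. a = bot \<or> a \<le> ereal (x - e)"
  proof (cases a)
    case (real r)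
    with ab(1) show ?thesis
      by (intro exI[of _ "x - r"]) (auto simp: bot_ereal_def)
  qed (use ab(1) in \<open>auto intro: exI[of _ 1] simp: bot_ereal_def\<close>)
  then obtain d where d: "d > 0" "a = bot \<or> a \<le> ereal (x - d)"
    by blast
  have "\<exists>e>0. b = top \<or> ereal (x + e) \<le> b"
  proof (cases b)
    case (real r)
    with ab(2) show ?thesis
      by (intro exI[of _ "r - x"]) (auto simp: top_ereal_def)
  qed (use ab(2) in \<open>auto intro: exI[of _ 1] simp: top_ereal_def\<close>)
  then obtain e where e: "e > 0" "b = top \<or> ereal (x + e) \<le> b"
    by blast
  show thesis
  proof (rule that[of "min d e"])
    fix I :: IR assume I: "ereal (x - min d e) < lower I" "upper I < ereal (x + min d e)"
    have "ereal (x - d) < lower I" "upper I < ereal (x + e)"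
      using I by (auto intro: le_less_trans[rotated] less_le_trans)
    then show "I \<in> U"
      using d(2) e(2) by (intro ab(3)) (auto intro: order.strict_trans1 order.strict_trans2)
  qed (use d e in simp)
qed

text \<open>The right side is the set of intervals meeting \<open>{0..1}\<close>, the lower closure
  of the points \<open>[x,x]\<close>. A closed support contains these points, since its open
  complement would otherwise have positive measure, and closed sets are lower sets.\<close>

lemma supp_lebesgue_image: "supp lebesgue_image = {I. lower I \<le> 1 \<and> 0 \<le> upper I}"
  unfolding supp_def
proof (rule Least_equality)
  let ?S = "{I :: IR. lower I \<le> 1 \<and> 0 \<le> upper I}"
  have "closed ?S"
    using closed_Int[OF closed_lower_le[of 1] closed_upper_ge[of 0]] by (simp add: Int_def)
  moreover have "support_of lebesgue_image ?S"
    by (rule support_of_mono[OF support_of_point_ivls]) auto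
  ultimately show "closed ?S \<and> support_of lebesgue_image ?S" ..
  fix C assume C: "closed C \<and> support_of lebesgue_image C"
  have pt: "point_ivl x \<in> C" if x: "x \<in> {0..1}" for x
  proof (rule ccontr)
    assume "point_ivl x \<notin> C"
    then obtain e where e: "e > 0" "\<And>I. ereal (x - e) < lower I \<Longrightarrow> upper I < ereal (x + e) \<Longrightarrow> I \<in> - C"
      using open_point_ivl_nhd[of "- C" x] C by (metis Compl_iff open_Compl)
    have "emeasure lebesgue_image (- C) > 0"
      using C by (intro emeasure_lebesgue_image_pos[OF _ x e(1)] e(2)) (auto simp: abs_less_iff)
    moreover have "emeasure lebesgue_image (- C) = 0"
      using C by (intro support_of_compl[of _ C]) auto
    ultimately show False
      by simp
  qed
  show "?S \<subseteq> C"
  proof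
    fix I assume I: "I \<in> ?S"
    obtain x where x: "x \<in> {0..1}" "I \<le> point_ivl x"
    proof -
      \<comment> \<open>The least common point of \<open>I\<close> and
        \<open>{0..1}\<close>.\<close>
      let ?m = "max 0 (lower I)"
      have m: "0 \<le> ?m" "?m \<le> 1" "lower I \<le> ?m" "?m \<le> upper I"
        using I lower_le_upper[of I] by auto
      then obtain x where "?m = ereal x"
        by (cases ?m) auto
      with m show thesis
        by (intro that[of x]) (auto simp: less_eq_ivl_def)
    qed
    show "I \<in> C"
    proof (rule ccontr)
      assume "I \<notin> C"
      moreover have "scott_open (- C)"
        using C by (simp add: open_ivl_def[symmetric] open_Compl)
      ultimately show False
        using scott_openD(1)[of "- C" I "point_ivl x"] x pt by blast
    qed
  qed
qed

text \<open>\<open>Q\<close> need not be closed, so compactness replaces the open complement. If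
  \<open>[x,x]\<close> is missing, saturation says that no member of \<open>Q\<close> contains
  \<open>x\<close>; by compactness all members keep a uniform distance from \<open>x\<close>, so
  \<open>Q\<close> misses a set of positive measure.\<close>

lemma point_ivl_in_compact_support:
  assumes Q: "Q \<in> sets borel" "compact Q" "saturated Q" "support_of lebesgue_image Q"
    and x: "x \<in> {0..1}"
  shows "point_ivl x \<in> Q"
proof (rule ccontr)
  assume notin: "point_ivl x \<notin> Q"
  \<comment> \<open>The intervals lying entirely to one side of \<open>x\<close>, at distance more
    than \<open>1 / Suc n\<close>.\<close>
  define U where "U n = {I. ereal (x + 1 / Suc n) < lower I} \<union> {I. upper I < ereal (x - 1 / Suc n)}" for n
  have U_mono: "U m \<subseteq> U n" if "m \<le> n" for m n
  proof -
    have "1 / real (Suc n) \<le> 1 / real (Suc m)"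
      using that by (intro divide_left_mono) auto
    then have "ereal (x + 1 / Suc n) \<le> ereal (x + 1 / Suc m)" "ereal (x - 1 / Suc m) \<le> ereal (x - 1 / Suc n)"
      by simp_all
    then show ?thesis
      unfolding U_def by (meson Un_mono Collect_mono le_less_trans less_le_trans)
  qed
  have "Q \<subseteq> (\<Union>n. U n)"
  proof
    fix I assume "I \<in> Q"
    then have "\<not> I \<le> point_ivl x"
      using notin saturatedD[OF Q(3)] by blast
    then consider "ereal x < lower I" | "upper I < ereal x"
      by (auto simp: less_eq_ivl_def not_le)
    then show "I \<in> (\<Union>n. U n)"
    proof cases
      case 1
      then obtain y where y: "ereal x < ereal y" "ereal y < lower I"
        using ereal_dense2 by blast
      then obtain n where "inverse (real (Suc n)) < y - x"
        using reals_Archimedean[of "y - x"] by auto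
      then have "ereal (x + 1 / Suc n) < lower I"
        using y(2) by (intro le_less_trans[OF _ y(2)]) (simp add: inverse_eq_divide)
      then show ?thesis
        by (auto simp: U_def)
    next
      case 2
      then obtain y where y: "upper I < ereal y" "ereal y < ereal x"
        using ereal_dense2 by blast
      then obtain n where "inverse (real (Suc n)) < x - y"
        using reals_Archimedean[of "x - y"] by auto
      then have "upper I < ereal (x - 1 / Suc n)"
        by (intro less_le_trans[OF y(1)]) (simp add: inverse_eq_divide)
      then show ?thesis
        by (auto simp: U_def)
    qed
  qed
  moreover have "open (U n)" for n
    unfolding U_def by (intro open_Un open_lower_greater open_upper_less)
  ultimately obtain F where F: "finite F" "Q \<subseteq> (\<Union>n\<in>F. U n)"
    using compactE_image[OF Q(2), of UNIV U] by auto
  \<comment> \<open>Inserting \<open>0\<close> keeps \<open>Max\<close> meaningful when the subcover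
    is empty.\<close>
  define N where "N = Max (insert 0 F)"
  have "U m \<subseteq> U N" if "m \<in> F" for m
    using F(1) that by (intro U_mono) (simp add: N_def)
  then have QU: "Q \<subseteq> U N"
    using F(2) by blast
  have "emeasure lebesgue_image (- Q) > 0"
  proof (rule emeasure_lebesgue_image_pos[OF _ x])
    show "0 < 1 / real (Suc N)"
      by simp
    fix y assume "\<bar>y - x\<bar> < 1 / real (Suc N)"
    then have "point_ivl y \<notin> U N"
      by (auto simp: U_def abs_less_iff)
    then show "point_ivl y \<in> - Q"
      using QU by blast
  qed (use Q(1) in auto)
  moreover have "emeasure lebesgue_image (- Q) = 0"
    using Q by (intro support_of_compl[OF Q(4)]) auto
  ultimately show False
    by simp
qed

text \<open>A Lebesgue number argument: otherwise pick a bad interval at each level. Along a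
  subsequence the right end-points converge to some \<open>l\<close>, the left ones follow because
  the lengths vanish, and the intervals enter a neighbourhood of \<open>[l,l]\<close> inside
  \<open>U\<close>.\<close>

lemma open_dyadic_ivl_cover:
  assumes U: "open U" "point_ivl ` {0..1} \<subseteq> U"
  shows "\<exists>n. \<forall>i\<in>{1..2^n}. dyadic_ivl n i \<in> U"
proof (rule ccontr)
  assume "\<not> ?thesis"
  then obtain i where i: "i n \<in> {1..2^n}" "dyadic_ivl n (i n) \<notin> U" for n
    by metis
  define t where "t n = real (i n) / 2^n" for n
  have "t n \<in> {0..1}" for n
    using i(1)[of n] by (simp add: t_def)
  then obtain l r where l: "l \<in> {0..1}" and r: "strict_mono r" "(t \<circ> r) \<longlonglongrightarrow> l"
    using compact_Icc[of 0 1, unfolded compact_def] by metis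
  obtain e where e: "e > 0" "\<And>I. ereal (l - e) < lower I \<Longrightarrow> upper I < ereal (l + e) \<Longrightarrow> I \<in> U"
    using open_point_ivl_nhd[OF U(1), of l] U(2) l by blast
  have "(\<lambda>n. (1 / 2) ^ r n) \<longlonglongrightarrow> (0::real)"
    using LIMSEQ_subseq_LIMSEQ[OF LIMSEQ_realpow_zero[of "1/2"] r(1)] by (simp add: o_def)
  then have "(\<lambda>n. (t \<circ> r) n - (1 / 2) ^ r n) \<longlonglongrightarrow> l"
    using tendsto_diff[OF r(2)] by fastforce
  then have "eventually (\<lambda>n. l - e < (t \<circ> r) n - (1 / 2) ^ r n) sequentially"
    "eventually (\<lambda>n. (t \<circ> r) n < l + e) sequentially"
    using e(1) order_tendstoD(1)[OF _, of _ l _ "l - e"] order_tendstoD(2)[OF r(2), of "l + e"] by auto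
  then have "eventually (\<lambda>n. dyadic_ivl (r n) (i (r n)) \<in> U) sequentially"
  proof eventually_elim
    case (elim n)
    then show ?case
      by (intro e(2)) (simp_all add: t_def diff_divide_distrib power_one_over)
  qed
  then show False
    using i(2) by simp
qed

section \<open>Boundedness with respect to the image measure\<close>

lemma bounded_wrt_lebesgue_imageD:
  assumes "bounded_wrt lebesgue_image f" "x \<in> {0..1}"
  shows "f (point_ivl x) < \<infinity>"
proof -
  obtain Q where Q: "Q \<in> sets borel" "compact Q" "saturated Q" "support_of lebesgue_image Q"
    "(SUP I \<in> Q \<inter> supp lebesgue_image. f I) < \<infinity>"
    using assms(1) unfolding bounded_wrt_def by auto
  have "point_ivl x \<in> Q \<inter> supp lebesgue_image"
    using point_ivl_in_compact_support[OF Q(1-4) assms(2)] assms(2) by (simp add: supp_lebesgue_image)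
  then show ?thesis
    using Q(5) by (meson SUP_upper le_less_trans)
qed

lemma dyadic_cell_eq_dyadic_ivl:
  assumes "x \<in> {0..<1}"
  obtains i where "i \<in> {1..2^n}" "dyadic_cell n x = dyadic_ivl n i"
proof (rule that)
  show i: "nat (\<lfloor>2^n * x\<rfloor> + 1) \<in> {1..2^n}"
    using assms dyadic_index by blast
  then have "real (nat (\<lfloor>2^n * x\<rfloor> + 1)) = \<lfloor>2^n * x\<rfloor> + 1"
    by auto
  then show "dyadic_cell n x = dyadic_ivl n (nat (\<lfloor>2^n * x\<rfloor> + 1))"
    by (simp only: dyadic_cell_def dyadic_ivl_def) simp
qed

lemma dyadic_ivl_le_point_ivl:
  assumes "x \<in> {0..1}"
  obtains i where "i \<in> {1..2^n}" "dyadic_ivl n i \<le> point_ivl x"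
proof (cases "x = 1")
  \<comment> \<open>The cell of \<open>1\<close> is out of range; the last interval of the level has
    \<open>1\<close> as its right end-point.\<close>
  case True
  show thesis
    by (rule that[of "2^n"]) (simp_all add: True less_eq_ivl_def)
next
  case False
  then have "x \<in> {0..<1}"
    using assms by simp
  then obtain i where i: "i \<in> {1..2^n}" "dyadic_cell n x = dyadic_ivl n i"
    by (rule dyadic_cell_eq_dyadic_ivl)
  have "dyadic_cell n x \<le> point_ivl x"
    using is_sup_dyadic_cell[of x] unfolding is_sup_in_def by blast
  with i show thesis
    by (intro that[of i]) simp_all
qed

text \<open>Forwards, finiteness at all \<open>[x,x]\<close> spreads to the intervals of some level
  by the covering lemma. Backwards, the points \<open>[x,x]\<close> form the required compact
  support, and by monotonicity the largest of finitely many values bounds the map on it.\<close>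

lemma bounded_wrt_lebesgue_image_iff:
  "bounded_wrt lebesgue_image (\<lambda>I. upper (lapp h I)) \<longleftrightarrow> (\<exists>n. upper (dyadic_valuation n h) < \<infinity>)"
  unfolding upper_dyadic_valuation_finite_iff
proof
  assume "bounded_wrt lebesgue_image (\<lambda>I. upper (lapp h I))"
  from bounded_wrt_lebesgue_imageD[OF this]
  have "point_ivl ` {0..1} \<subseteq> {I. upper (lapp h I) < \<infinity>}"
    by auto
  from open_dyadic_ivl_cover[OF open_upper_lmap this]
  show "\<exists>n. \<forall>i\<in>{1..2^n}. upper (lapp h (dyadic_ivl n i)) < \<infinity>"
    by simp
next
  assume "\<exists>n. \<forall>i\<in>{1..2^n}. upper (lapp h (dyadic_ivl n i)) < \<infinity>"
  then obtain n where n: "\<And>i. i \<in> {1..2^n} \<Longrightarrow> upper (lapp h (dyadic_ivl n i)) < \<infinity>"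
    by blast
  let ?Q = "point_ivl ` {0..1}"
  define M where "M = Max ((\<lambda>i. upper (lapp h (dyadic_ivl n i))) ` {1..2^n})"
  have "M \<in> (\<lambda>i. upper (lapp h (dyadic_ivl n i))) ` {1..2^n}"
    unfolding M_def by (intro Max_in) auto
  then have "M < \<infinity>"
    using n by auto
  have "upper (lapp h I) \<le> M" if I: "I \<in> ?Q" for I
  proof -
    obtain x where x: "x \<in> {0..1}" "I = point_ivl x"
      using I by blast
    obtain i where i: "i \<in> {1..2^n}" "dyadic_ivl n i \<le> I"
      using dyadic_ivl_le_point_ivl[OF x(1)] unfolding x(2) .
    have "upper (lapp h I) \<le> upper (lapp h (dyadic_ivl n i))"
      using monoD[OF mono_lapp i(2), of h] unfolding less_eq_ivl_def by (rule conjunct2)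
    also have "\<dots> \<le> M"
      unfolding M_def using i(1) by (intro Max_ge) auto
    finally show ?thesis .
  qed
  then have "(SUP I \<in> ?Q \<inter> supp lebesgue_image. upper (lapp h I)) \<le> M"
    by (intro SUP_least) blast
  then have fin: "(SUP I \<in> ?Q \<inter> supp lebesgue_image. upper (lapp h I)) < \<infinity>"
    using \<open>M < \<infinity>\<close> by (rule le_less_trans)
  \<comment> \<open>The set is compact but not closed, so its measurability is read off from a
    description by end-points.\<close>
  have Q: "?Q = {I. lower I = upper I \<and> 0 \<le> lower I \<and> lower I \<le> 1}"
  proof safe
    fix I :: IR assume I: "lower I = upper I" "0 \<le> lower I" "lower I \<le> 1"
    from I(2,3) obtain x where x: "lower I = ereal x"
      by (cases "lower I") auto
    then have "I = point_ivl x"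
      using I(1) by (simp add: ivl_eq_iff)
    then show "I \<in> ?Q"
      using I(2,3) x by simp
  qed auto
  have "{I :: IR. lower I = upper I \<and> 0 \<le> lower I \<and> lower I \<le> 1} \<in> sets borel"
    by measurable
  then have borel: "?Q \<in> sets borel"
    unfolding Q .
  have "compact ?Q"
    by (intro compact_continuous_image continuous_on_subset[OF continuous_on_point_ivl]) auto
  have "saturated ?Q"
  \<comment> \<open>Degenerate intervals with finite end-points are maximal, so nothing lies
    strictly above them.\<close>
  proof (rule saturated_up_closed)
    fix I J assume "I \<in> ?Q" "I \<le> J"
    then obtain x where x: "x \<in> {0..1}" "ereal x \<le> lower J" "upper J \<le> ereal x"
      by (auto simp: less_eq_ivl_def)
    have "lower J = ereal x" "upper J = ereal x"
      using x(2,3) lower_le_upper[of J] by (meson antisym order_trans)+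
    then have "J = point_ivl x"
      by (simp add: ivl_eq_iff)
    then show "J \<in> ?Q"
      using x(1) by blast
  qed
  with fin \<open>compact ?Q\<close> show "bounded_wrt lebesgue_image (\<lambda>I. upper (lapp h I))"
    unfolding bounded_wrt_def using support_of_point_ivls borel
    by (intro exI[of _ ?Q]) (simp only: sets_lebesgue_image simp_thms)
qed

section \<open>The valuation of the image measure\<close>

lemma bounds_measure_valuation [simp]:
  "lower (measure_valuation \<mu> h) = lower_integral \<mu> (\<lambda>x. lower (lapp h x))"
  "upper (measure_valuation \<mu> h) = upper_integral \<mu> (\<lambda>x. upper (lapp h x))"
  by (simp_all add: measure_valuation_def measure_valuation_well_formed)

lemma lower_integral_lebesgue_image:
  assumes "f \<in> borel_measurable borel"
  shows "lower_integral lebesgue_image f = (\<integral>\<^sup>+x. f (point_ivl x) * indicator {0..<1} x \<partial>lborel)"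
  using assms by (subst lower_integral_eq) (simp_all add: nn_integral_lebesgue_image)

text \<open>Monotone convergence gives the left end-point. On the right, either some integral is
  finite and decreasing convergence applies, or all are infinite and boundedness fails, so both
  sides are \<open>\<infinity>\<close>.\<close>

lemma measure_valuation_lebesgue_image:
  "is_sup ((\<lambda>n. dyadic_valuation n h) ` UNIV) (measure_valuation lebesgue_image h)"
proof -
  let ?l = "\<lambda>n x. lower (lapp h (dyadic_cell n x)) * indicator {0..<1::real} x"
  let ?u = "\<lambda>n x. upper (lapp h (dyadic_cell n x)) * indicator {0..<1::real} x"
  have "(\<integral>\<^sup>+x. lower (lapp h (point_ivl x)) * indicator {0..<1} x \<partial>lborel) =
      (\<integral>\<^sup>+x. (SUP n. ?l n x) \<partial>lborel)"
    by (simp add: lower_lapp_point_ivl SUP_mult_right_ennreal)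
  also have "\<dots> = (SUP n. \<integral>\<^sup>+x. ?l n x \<partial>lborel)"
    by (intro nn_integral_monotone_convergence_SUP borel_measurable_dyadic_cell)
      (auto simp: incseq_def le_fun_def intro!: mult_right_mono lapp_dyadic_cell_mono)
  finally have lower: "lower (measure_valuation lebesgue_image h) = (SUP n. lower (dyadic_valuation n h))"
    by (simp add: lower_integral_lebesgue_image borel_measurable_lmap lower_dyadic_valuation)
  have upper: "upper (measure_valuation lebesgue_image h) = (INF n. upper (dyadic_valuation n h))"
  proof (cases "\<exists>n. upper (dyadic_valuation n h) < \<infinity>")
    case True
    then obtain N where N: "upper (dyadic_valuation N h) < \<infinity>"
      by blast
    have "(\<integral>\<^sup>+x. upper (lapp h (point_ivl x)) * indicator {0..<1} x \<partial>lborel) =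
        (\<integral>\<^sup>+x. (INF n. ?u n x) \<partial>lborel)"
      by (intro nn_integral_cong) (simp add: upper_lapp_point_ivl indicator_def)
    also have "\<dots> = (INF n. \<integral>\<^sup>+x. ?u n x \<partial>lborel)"
    proof (rule nn_integral_monotone_convergence_INF_decseq)
      show "decseq ?u"
        unfolding decseq_def
        by (intro allI impI le_funI mult_right_mono lapp_dyadic_cell_mono) simp_all
      show "(\<integral>\<^sup>+x. ?u N x \<partial>lborel) < \<infinity>"
        using N by (simp add: upper_dyadic_valuation)
    qed (rule borel_measurable_dyadic_cell)
    finally show ?thesis
      using True
      by (simp add: upper_integral_def bounded_wrt_lebesgue_image_iff lower_integral_lebesgue_image
          borel_measurable_lmap upper_dyadic_valuation)
  next
    case False
    then show ?thesis
      by (simp add: upper_integral_def bounded_wrt_lebesgue_image_iff not_less top_unique)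
  qed
  have "directed (range (\<lambda>n. dyadic_valuation n h))"
    using incseq_dyadic_valuation
    by (intro directed_range_incseq) (auto simp: incseq_def le_fun_def)
  then show ?thesis
    using lower upper by (simp add: is_sup_ivl_iff)
qed

lemma approximates_measure_valuation: "approximates (measure_valuation \<mu>) \<mu>"
proof -
  have "lower_integral \<mu> f \<le> upper_integral \<mu> g" if "\<And>x. f x \<le> g x" for f g
    using lower_integral_mono[of f g \<mu>] that by (simp add: upper_integral_def)
  then show ?thesis
    by (auto simp: approximates_def lmap_approximates_def ivl_approximates_def intro: lower_integral_mono)
qed

section \<open>Maximality\<close>

text \<open>Meant for closed \<open>C\<close>: then the right end-point is upper semicontinuous and
  the map continuous, as \<open>Lmap\<close> requires.\<close>

definition infinite_on :: "'a::topological_space set \<Rightarrow> 'a lmap" where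
  "infinite_on C = Lmap (\<lambda>x. Ivl (0, if x \<in> C then \<infinity> else 0))"

lemma bounds_infinite_on:
  assumes "closed C"
  shows "lower (lapp (infinite_on C) x) = 0"
    and "upper (lapp (infinite_on C) x) = (if x \<in> C then \<infinity> else 0)"
proof -
  have "{x. (if x \<in> C then \<infinity> else 0) < c} = (if c = 0 then {} else - C)" for c :: ennreal
    by (auto simp: zero_less_iff_neq_zero)
  then have "lapp (infinite_on C) = (\<lambda>x. Ivl (0, if x \<in> C then \<infinity> else 0))"
    unfolding infinite_on_def using assms by (intro lapp_Lmap_ivl) (simp_all add: open_Compl)
  then show "lower (lapp (infinite_on C) x) = 0"
    "upper (lapp (infinite_on C) x) = (if x \<in> C then \<infinity> else 0)"
    by simp_all
qed

lemma is_sup_infinite_on: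
  fixes C :: "nat \<Rightarrow> 'a::topological_space set"
  assumes C: "\<And>n. closed (C n)"
  shows "is_sup (range (\<lambda>n. infinite_on (C n))) (infinite_on (\<Inter>n. C n))"
proof (intro is_sup_lmapI is_sup_ivlI)
  fix x
  have closed_Int: "closed (\<Inter>n. C n)"
    using C by blast
  show "lower (lapp (infinite_on (\<Inter>n. C n)) x) =
      (SUP I\<in>(\<lambda>h. lapp h x) ` range (\<lambda>n. infinite_on (C n)). lower I)"
    unfolding image_image bounds_infinite_on[OF C] bounds_infinite_on[OF closed_Int] by simp
  have "(if x \<in> (\<Inter>n. C n) then \<infinity> else 0 :: ennreal) = (INF n. if x \<in> C n then \<infinity> else 0)"
  proof (cases "x \<in> (\<Inter>n. C n)")
    case False
    then obtain n where "x \<notin> C n"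
      by blast
    then have "(INF n. if x \<in> C n then \<infinity> else 0 :: ennreal) \<le> 0"
      by (intro INF_lower2[of n]) auto
    then show ?thesis
      using False by simp
  qed simp
  then show "upper (lapp (infinite_on (\<Inter>n. C n)) x) =
      (INF I\<in>(\<lambda>h. lapp h x) ` range (\<lambda>n. infinite_on (C n)). upper I)"
    unfolding image_image bounds_infinite_on[OF C] bounds_infinite_on[OF closed_Int] .
qed

text \<open>The test function equal to \<open>\<infinity>\<close> on \<open>C\<close> and
  \<open>0\<close> elsewhere is approximated by \<open>infinite_on C\<close> and has infinite
  integral.\<close>

lemma upper_infinite_on:
  assumes \<nu>: "approximates \<nu> \<mu>" and C: "closed C" "C \<in> sets \<mu>" "emeasure \<mu> C > 0"
  shows "upper (\<nu> (infinite_on C)) = \<infinity>"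
proof -
  let ?f = "\<lambda>x. \<infinity> * indicator C x :: ennreal"
  have [measurable]: "C \<in> sets \<mu>"
    by fact
  have f: "?f \<in> borel_measurable \<mu>"
    by measurable
  have "lmap_approximates (infinite_on C) ?f"
    by (simp add: lmap_approximates_def ivl_approximates_def bounds_infinite_on[OF C(1)] indicator_def)
  then have "lower_integral \<mu> ?f \<le> upper (\<nu> (infinite_on C))"
    using \<nu> f unfolding approximates_def ivl_approximates_def by blast
  moreover have "lower_integral \<mu> ?f = \<infinity> * emeasure \<mu> C"
    unfolding lower_integral_eq[OF f] using C(2) by (rule nn_integral_cmult_indicator)
  then have "lower_integral \<mu> ?f = \<infinity>"
    using C(3) by (simp add: ennreal_top_mult)
  ultimately show ?thesis
    by (simp add: top_unique)
qed

text \<open>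
  Where \<open>h\<^sup>+\<close> takes the value \<open>\<infinity>\<close> on a null set only, its integral says nothing about \<open>\<nu>(h)\<close>;
  but \<open>0 \<cdot>\<^sub>r \<infinity> = \<infinity>\<close>, so \<open>0 \<times> h\<close> lies below a supremum of maps that are \<open>[0, \<infinity>]\<close> on
  sets of positive measure, and Scott continuity forces \<open>0 \<cdot>\<^sub>r \<nu>(h)\<^sup>+ = \<infinity>\<close>.
\<close>
lemma upper_valuation_infinite:
  assumes val: "\<nu> \<in> valuations" and app: "approximates \<nu> lebesgue_image"
    and x: "x \<in> {0..1}" "upper (lapp h (point_ivl x)) = \<infinity>"
  shows "upper (\<nu> h) = \<infinity>"
proof -
  \<comment> \<open>The intervals meeting the closed \<open>1 / Suc n\<close>-neighbourhood of
    \<open>x\<close>; each \<open>C n\<close> has positive measure, and they shrink to the intervals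
    containing \<open>x\<close>.\<close>
  define C where "C n = {I. lower I \<le> ereal (x + 1 / Suc n)} \<inter> {I. ereal (x - 1 / Suc n) \<le> upper I}" for n
  have closed: "closed (C n)" for n
    unfolding C_def by (intro closed_Int closed_lower_le closed_upper_ge)
  have anti: "C n \<subseteq> C m" if "m \<le> n" for m n
  proof -
    have "1 / real (Suc n) \<le> 1 / real (Suc m)"
      using that by (intro divide_left_mono) auto
    then have "ereal (x + 1 / Suc n) \<le> ereal (x + 1 / Suc m)" "ereal (x - 1 / Suc m) \<le> ereal (x - 1 / Suc n)"
      by simp_all
    then show ?thesis
      unfolding C_def by (intro Int_mono Collect_mono; blast intro: order_trans)
  qed
  have top_C: "upper (\<nu> (infinite_on (C n))) = \<infinity>" for n
  proof (rule upper_infinite_on[OF app closed])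
    show "C n \<in> sets lebesgue_image"
      using closed by simp
    show "emeasure lebesgue_image (C n) > 0"
      using closed by (intro emeasure_lebesgue_image_pos[OF _ x(1), of _ "1 / Suc n"]) (auto simp: C_def abs_less_iff)
  qed
  have dir: "directed (range (\<lambda>n. infinite_on (C n)))"
  proof (intro directed_range_incseq incseq_def[THEN iffD2] allI impI)
    fix m n :: nat assume "m \<le> n"
    then show "infinite_on (C m) \<le> infinite_on (C n)"
      using anti[of m n] by (auto simp: less_eq_lmap.rep_eq less_eq_ivl_def bounds_infinite_on[OF closed])
  qed
  have "is_sup (\<nu> ` range (\<lambda>n. infinite_on (C n))) (\<nu> (infinite_on (\<Inter>n. C n)))"
    by (rule valuationsD(2)[OF val dir is_sup_infinite_on[OF closed]])
  from directed_ivl_bounds(2)[OF directed_image[OF dir valuationsD(1)[OF val]] this]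
  have top: "upper (\<nu> (infinite_on (\<Inter>n. C n))) = \<infinity>"
    by (simp add: image_image top_C)
  have below: "I \<le> point_ivl x" if "I \<in> (\<Inter>n. C n)" for I
  proof -
    have I: "lower I \<le> ereal (x + 1 / Suc n)" "ereal (x - 1 / Suc n) \<le> upper I" for n
      using that by (auto simp: C_def)
    have inv: "(\<lambda>n. 1 / real (Suc n)) \<longlonglongrightarrow> 0"
      using LIMSEQ_inverse_real_of_nat by (simp only: inverse_eq_divide)
    have "(\<lambda>n. ereal (x + 1 / Suc n)) \<longlonglongrightarrow> ereal (x + 0)" "(\<lambda>n. ereal (x - 1 / Suc n)) \<longlonglongrightarrow> ereal (x - 0)"
      by (intro tendsto_intros inv)+
    from LIMSEQ_le_const[OF this(1)] LIMSEQ_le_const2[OF this(2)]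
    have "lower I \<le> ereal x" "ereal x \<le> upper I"
      using I by simp_all
    then show ?thesis
      by (simp add: less_eq_ivl_def)
  qed
  \<comment> \<open>Each such interval lies below \<open>[x,x]\<close>, and right end-points of
    \<open>h\<close> decrease along the order.\<close>
  have inf: "upper (lapp h I) = \<infinity>" if "I \<in> (\<Inter>n. C n)" for I
    using monoD[OF mono_lapp below[OF that], of h] x(2) by (simp add: less_eq_ivl_def top_unique)
  have "closed (\<Inter>n. C n)"
    using closed by blast
  note bounds = bounds_infinite_on[OF this]
  \<comment> \<open>Both left ends are \<open>0\<close>. On the intersection
    \<open>mult_r 0 \<infinity> = \<infinity>\<close>; elsewhere the right end of
    \<open>infinite_on\<close> is \<open>0\<close>.\<close>
  have "scale_lmap 0 h \<le> infinite_on (\<Inter>n. C n)"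
    unfolding less_eq_lmap.rep_eq less_eq_ivl_def scale_lmap.rep_eq bounds upper_times lower_times
    using inf by (simp add: mult_r_def)
  then have "\<nu> (scale_lmap 0 h) \<le> \<nu> (infinite_on (\<Inter>n. C n))"
    by (rule monoD[OF valuationsD(1)[OF val]])
  \<comment> \<open>\<open>mult_r 0 b\<close> is infinite only for infinite
    \<open>b\<close>.\<close>
  then have "mult_r 0 (upper (\<nu> h)) = \<infinity>"
    using top by (simp add: valuationsD(3)[OF val] less_eq_ivl_def top_unique)
  then show ?thesis
    by (auto simp: mult_r_def split: if_splits)
qed

text \<open>Both end-point functions of \<open>h\<close> serve as test functions. This settles the
  left end, and the right end when \<open>h\<close> is finite at all \<open>[x,x]\<close>, where the
  upper integral equals the lower one; otherwise \<open>\<nu> h\<close> has right end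
  \<open>\<infinity>\<close>.\<close>

lemma approximating_valuation_le:
  assumes val: "\<nu> \<in> valuations" and app: "approximates \<nu> lebesgue_image"
  shows "\<nu> h \<le> measure_valuation lebesgue_image h"
proof -
  let ?l = "\<lambda>I. lower (lapp h I)" and ?u = "\<lambda>I. upper (lapp h I)"
  have meas: "?l \<in> borel_measurable lebesgue_image" "?u \<in> borel_measurable lebesgue_image"
    using borel_measurable_lmap[of h] by simp_all
  have "lmap_approximates h ?l" "lmap_approximates h ?u"
    by (simp_all add: lmap_approximates_def ivl_approximates_def lower_le_upper)
  then have ineq: "lower (\<nu> h) \<le> lower_integral lebesgue_image ?l"
    "lower_integral lebesgue_image ?u \<le> upper (\<nu> h)"
    using app meas unfolding approximates_def ivl_approximates_def by blast+
  have "upper_integral lebesgue_image ?u \<le> upper (\<nu> h)"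
  proof (cases "\<exists>x\<in>{0..1}. ?u (point_ivl x) = \<infinity>")
    case True
    then show ?thesis
      using upper_valuation_infinite[OF val app] by auto
  next
    case False
    then have "point_ivl ` {0..1} \<subseteq> {I. ?u I < \<infinity>}"
      by (auto simp: less_top)
    from open_dyadic_ivl_cover[OF open_upper_lmap this]
    have "bounded_wrt lebesgue_image ?u"
      unfolding bounded_wrt_lebesgue_image_iff upper_dyadic_valuation_finite_iff by simp
    then show ?thesis
      using ineq(2) by (simp add: upper_integral_def)
  qed
  then show ?thesis
    using ineq(1) by (simp add: less_eq_ivl_def)
qed

section \<open>Identification of the supremum and its maximality\<close>

theorem theorem9p3:
  shows "range dyadic_valuation \<subseteq> valuations \<and> incseq dyadic_valuation \<and>
    is_sup_in valuations (range dyadic_valuation) lambda_bar \<and>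
    lambda_bar = measure_valuation lebesgue_image \<and>
    (lambda_bar \<in> valuations \<and> approximates lambda_bar lebesgue_image \<and>
      (\<forall>\<nu>\<in>valuations. approximates \<nu> lebesgue_image \<longrightarrow> \<nu> \<le> lambda_bar)) \<and>
    measure_valuation lebesgue_image \<in> minimal_valuations"
proof -
  have sub: "range dyadic_valuation \<subseteq> valuations"
    using dyadic_valuation_elementary elementary_subset_valuations by blast
  have dir: "directed (range dyadic_valuation)"
    by (rule directed_range_incseq[OF incseq_dyadic_valuation])
  have sup: "is_sup_in valuations (range dyadic_valuation) (measure_valuation lebesgue_image)"
    using measure_valuation_lebesgue_image
    by (intro pointwise_sup_in_valuations sub dir) (simp add: image_image)
  \<comment> \<open>Suprema are unique, so the definite description in \<open>valuation_sup\<close>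
    selects this one.\<close>
  then have eq: "lambda_bar = measure_valuation lebesgue_image"
    unfolding lambda_bar_def valuation_sup_def by (intro the_equality is_sup_in_unique)
  moreover have "measure_valuation lebesgue_image \<in> valuations"
    using sup by (simp add: is_sup_in_def)
  moreover have "measure_valuation lebesgue_image \<in> minimal_valuations"
    using dyadic_valuation_elementary
    by (intro minimal_valuations.directed_sup[OF _ dir sup]) (auto intro: minimal_valuations.elementary)
  ultimately show ?thesis
    using sub sup incseq_dyadic_valuation unfolding eq
    by (simp add: approximates_measure_valuation approximating_valuation_le le_fun_def)
qed

end
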